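(* Let $X$ be a Banach space over the real or complex scalars and let $(x_n)_{n\in\mathbb{N}}\subset X$ be a seminormalized, weakly null sequence. (i) For any $\varepsilon>0$ and any sequence $(q_i)_{i\geqslant 0}$ of natural numbers, there exists a subsequence $(y_n)$ of $(x_n)$ such that for any $n\in\mathbb{N}$, any set $E\subset\mathbb{N}$ with $n<\min E$ and $|E|\leqslant q_n$, and any $(a_i)\in c_{00}$, $$\Bigl\|\sum_{i=1}^n a_i y_i+\sum_{i\in E}a_i y_i\Bigr\|\leqslant (1+\varepsilon)\Bigl\|\sum_{i} a_i y_i\Bigr\|.$$ (ii) Suppose that no subsequence of $(x_n)$ generates a spreading model equivalent to the canonical $c_0$ basis. For any $\varepsilon>0$ and any sequence $(\delta_n)_{n\geqslant 0}\subset(0,1)$, there exists a subsequence $(y_n)$ of $(x_n)$ such that for any $(a_i)\in c_{00}$ with $\sup_{i\in\mathbb{N}}|a_i|\leqslant 1$, any $n\in\mathbb{N}$, and any set $E\subset\{i\in\mathbb{N}: n<i,\ |a_i|\geqslant\delta_n\}$, $$\Bigl\|\sum_{i=1}^n a_i y_i+\sum_{i\in E}a_i y_i\Bigr\|\leqslant (1+\varepsilon)\Bigl\|\sum_{i} a_i y_i\Bigr\|.$$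
   Context: $\mathbb{N}=\{1,2,\ldots\}$. $c_{00}$ denotes the space of scalar sequences with finite support. A sequence $(x_n)$ is seminormalized if $0<\inf_n\|x_n\|\leqslant\sup_n\|x_n\|<\infty$. A sequence $(x_n)$ in a Banach space generates (has) the sequence $(s_n)$ in a possibly different Banach space as a spreading model if for each $k\in\mathbb{N}$ and $\varepsilon>0$ there exists $m=m(k,\varepsilon)$ such that for any $m\leqslant n_1<\cdots<n_k$ and any scalars $(a_i)_{i=1}^k$ with $|a_i|\leqslant 1$ for all $i$, $\bigl|\,\|\sum_{i=1}^k a_i s_i\|-\|\sum_{i=1}^k a_i x_{n_i}\|\,\bigr|<\varepsilon$. The sequence $(s_n)$ is equivalent to the canonical $c_0$ basis if there are constants $0<c\leqslant C<\infty$ such that $c\max_i|a_i|\leqslant\|\sum_i a_i s_i\|\leqslant C\max_i|a_i|$ for all $(a_i)\in c_{00}$. *)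

theory Defs
  imports "HOL-Analysis.Analysis" "HOL-Library.Function_Algebras"
begin

text \<open>
  The scalar field is a type of class \<open>real_normed_field\<close> and \<open>euclidean_space\<close>. By the theorem of
  Frobenius such a field, being a finite-dimensional real division algebra with multiplicative norm,
  is isometrically isomorphic to \<open>\<real>\<close> or to \<open>\<complex>\<close> with the usual absolute value; both types
  \<open>real\<close> and \<open>complex\<close> are instances. A Banach space over the scalars is a type of
  class \<open>banach\<close> together with a scalar multiplication as in the following locale.
\<close>

locale normed_space_over = vector_space sc
  for sc :: "'k::{real_normed_field, euclidean_space} \<Rightarrow> 'a::real_normed_vector \<Rightarrow> 'a" +
  assumes norm_scale: "norm (sc c v) = norm c * norm v"
    and scale_of_real: "sc (of_real r) v = r *\<^sub>R v"

lemma normed_space_over_scaleR: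
  "normed_space_over (scaleR :: real \<Rightarrow> 'a::real_normed_vector \<Rightarrow> 'a)"
  by unfold_locales (simp_all add: algebra_simps)

lemma normed_space_over_complex: "normed_space_over ((*) :: complex \<Rightarrow> complex \<Rightarrow> complex)"
  by unfold_locales (simp_all add: algebra_simps norm_mult scaleR_conv_of_real)

text \<open>
  A Banach space over \<open>'k\<close> given by a linear subspace \<open>V\<close> of an ambient vector space and a
  complete norm \<open>N\<close> on \<open>V\<close>. The values of \<open>N\<close> outside \<open>V\<close> are irrelevant.
\<close>

locale banach_space_on = vector_space sc
  for sc :: "'k::real_normed_field \<Rightarrow> 'v::ab_group_add \<Rightarrow> 'v" +
  fixes V :: "'v set" and N :: "'v \<Rightarrow> real"
  assumes subspace_V: "subspace V"
    and N_nonneg: "v \<in> V \<Longrightarrow> 0 \<le> N v"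
    and N_eq_0: "v \<in> V \<Longrightarrow> N v = 0 \<longleftrightarrow> v = 0"
    and N_scale: "v \<in> V \<Longrightarrow> N (sc c v) = norm c * N v"
    and N_triangle: "v \<in> V \<Longrightarrow> w \<in> V \<Longrightarrow> N (v + w) \<le> N v + N w"
    and N_complete:
      "\<lbrakk>range u \<subseteq> V; \<And>e. 0 < e \<Longrightarrow> \<exists>M. \<forall>m\<ge>M. \<forall>n\<ge>M. N (u m - u n) < e\<rbrakk>
        \<Longrightarrow> \<exists>v\<in>V. (\<lambda>n. N (u n - v)) \<longlonglongrightarrow> 0"

definition seq_scale :: "'k::real_normed_field \<Rightarrow> (nat \<Rightarrow> 'k) \<Rightarrow> nat \<Rightarrow> 'k" where
  "seq_scale c f = (\<lambda>j. c * f j)"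

definition c00 :: "(nat \<Rightarrow> 'k::zero) set" where
  "c00 = {a. finite {i. a i \<noteq> 0}}"

text \<open>
  Sequences are indexed from 0: the entry with index \<open>i\<close> is the \<open>(i+1)\<close>-st term. So the first
  \<open>n\<close> terms have the indices \<open>i < n\<close>, and the terms after them the indices \<open>i \<ge> n\<close>.
\<close>

text \<open>The sum \<open>\<Sum>\<^sub>i a\<^sub>i s\<^sub>i\<close> for a finitely supported \<open>a\<close>.\<close>

definition lincomb ::
  "('k::zero \<Rightarrow> 'v::comm_monoid_add \<Rightarrow> 'v) \<Rightarrow> (nat \<Rightarrow> 'k) \<Rightarrow> (nat \<Rightarrow> 'v) \<Rightarrow> 'v" where
  "lincomb sc a s = (\<Sum>i | a i \<noteq> 0. sc (a i) (s i))"

definition seminormalized :: "(nat \<Rightarrow> 'a::real_normed_vector) \<Rightarrow> bool" where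
  "seminormalized x \<longleftrightarrow> 0 < (INF n. norm (x n)) \<and> bdd_above (range (\<lambda>n. norm (x n)))"

definition weakly_null ::
  "('k::real_normed_field \<Rightarrow> 'a::real_normed_vector \<Rightarrow> 'a) \<Rightarrow> (nat \<Rightarrow> 'a) \<Rightarrow> bool" where
  "weakly_null sc x \<longleftrightarrow>
     (\<forall>f :: 'a \<Rightarrow> 'k. Vector_Spaces.linear sc (*) f \<and> (\<exists>B. \<forall>v. norm (f v) \<le> B * norm v)
        \<longrightarrow> (\<lambda>n. f (x n)) \<longlonglongrightarrow> 0)"

text \<open>
  The sequence \<open>x\<close>, in a space with scalar multiplication \<open>sc\<close> and norm \<open>N\<close>, generates the
  sequence \<open>s\<close>, in a space with scalar multiplication \<open>sc'\<close> and norm \<open>N'\<close>, as a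
  spreading model.
\<close>

definition generates_spreading_model ::
  "('k::real_normed_field \<Rightarrow> 'a::comm_monoid_add \<Rightarrow> 'a) \<Rightarrow> ('a \<Rightarrow> real) \<Rightarrow> (nat \<Rightarrow> 'a)
    \<Rightarrow> ('k \<Rightarrow> 'b::comm_monoid_add \<Rightarrow> 'b) \<Rightarrow> ('b \<Rightarrow> real) \<Rightarrow> (nat \<Rightarrow> 'b) \<Rightarrow> bool" where
  "generates_spreading_model sc N x sc' N' s \<longleftrightarrow>
     (\<forall>k\<ge>1. \<forall>\<epsilon>>0. \<exists>m. \<forall>n a.
        strict_mono_on {..<k} n \<and> (\<forall>i<k. m \<le> n i) \<and> (\<forall>i<k. norm (a i) \<le> 1) \<longrightarrow>
        \<bar>N' (\<Sum>i<k. sc' (a i) (s i)) - N (\<Sum>i<k. sc (a i) (x (n i)))\<bar> < \<epsilon>)"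

definition equivalent_c0_basis ::
  "('k::real_normed_field \<Rightarrow> 'b::comm_monoid_add \<Rightarrow> 'b) \<Rightarrow> ('b \<Rightarrow> real) \<Rightarrow> (nat \<Rightarrow> 'b) \<Rightarrow> bool" where
  "equivalent_c0_basis sc N s \<longleftrightarrow>
     (\<exists>c C. 0 < c \<and> c \<le> C \<and>
        (\<forall>a\<in>c00. c * (MAX i. norm (a i)) \<le> N (lincomb sc a s) \<and>
                 N (lincomb sc a s) \<le> C * (MAX i. norm (a i))))"

text \<open>
  Since one cannot quantify over types, the spreading model ranges over the sequences in Banach
  spaces whose underlying vector space is a linear subspace of the space of all scalar sequences,
  with an arbitrary complete norm. Up to isometric isomorphism these include all separable
  Banach spaces (a linear space of dimension at most the continuum embeds linearly into the space of
  scalar sequences). Lemma \<open>has_c0_spreading_modelI\<close> below shows that nothing is lost.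
\<close>

definition has_c0_spreading_model ::
  "('k::real_normed_field \<Rightarrow> 'a::real_normed_vector \<Rightarrow> 'a) \<Rightarrow> (nat \<Rightarrow> 'a) \<Rightarrow> bool" where
  "has_c0_spreading_model sc x \<longleftrightarrow>
     (\<exists>V N (s :: nat \<Rightarrow> nat \<Rightarrow> 'k).
        banach_space_on seq_scale V N \<and> range s \<subseteq> V \<and>
        generates_spreading_model sc norm x seq_scale N s \<and>
        equivalent_c0_basis seq_scale N s)"

lemma sum_seq_scale_unit:
  fixes a :: "nat \<Rightarrow> 'k::real_normed_field"
  assumes "finite F"
  shows "(\<Sum>i\<in>F. seq_scale (a i) (\<lambda>j. if j = i then 1 else 0)) = (\<lambda>j. if j \<in> F then a j else 0)"
  using assms
proof (induction F rule: finite_induct)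
  case empty
  then show ?case by (simp add: zero_fun_def)
next
  case (insert x F)
  then show ?case by (auto simp: seq_scale_def fun_eq_iff)
qed

lemma vector_space_seq_scale: "vector_space (seq_scale :: 'k::real_normed_field \<Rightarrow> _)"
  by unfold_locales (auto simp: seq_scale_def fun_eq_iff algebra_simps)

lemma c0_realization:
  fixes sc :: "'k::{real_normed_field, euclidean_space} \<Rightarrow> 'b::banach \<Rightarrow> 'b"
  assumes "normed_space_over sc" and eq: "equivalent_c0_basis sc norm s"
  obtains V N and s' :: "nat \<Rightarrow> nat \<Rightarrow> 'k"
  where "banach_space_on seq_scale V N" "range s' \<subseteq> V"
    "\<And>F a. finite F \<Longrightarrow> N (\<Sum>i\<in>F. seq_scale (a i) (s' i)) = norm (\<Sum>i\<in>F. sc (a i) (s i))"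
proof -
  interpret normed_space_over sc by fact
  obtain c C where c: "0 < c" "c \<le> C" and
    bd: "\<And>a. a \<in> c00 \<Longrightarrow> c * (MAX i. norm (a i)) \<le> norm (lincomb sc a s)"
        "\<And>a. a \<in> c00 \<Longrightarrow> norm (lincomb sc a s) \<le> C * (MAX i. norm (a i))"
    using eq unfolding equivalent_c0_basis_def by blast
  have trunc: "(\<lambda>i. if i \<in> F then a i else 0) \<in> c00"
       "lincomb sc (\<lambda>i. if i \<in> F then a i else 0) s = (\<Sum>i\<in>F. sc (a i) (s i))"
       "finite (range (\<lambda>i. norm (if i \<in> F then a i else 0)))"
    if "finite F" for F and a :: "nat \<Rightarrow> 'k"
  proof -
    show "(\<lambda>i. if i \<in> F then a i else 0) \<in> c00"
      using that by (auto simp: c00_def)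
    show "lincomb sc (\<lambda>i. if i \<in> F then a i else 0) s = (\<Sum>i\<in>F. sc (a i) (s i))"
      unfolding lincomb_def using that by (intro sum.mono_neutral_cong_left) (auto split: if_splits)
    have "range (\<lambda>i. norm (if i \<in> F then a i else 0)) \<subseteq> insert 0 ((\<lambda>i. norm (a i)) ` F)"
      by auto
    then show "finite (range (\<lambda>i. norm (if i \<in> F then a i else 0)))"
      using that by (meson finite.insertI finite_imageI finite_subset)
  qed
  have up: "norm (\<Sum>i\<in>F. sc (a i) (s i)) \<le> C * M"
    if "finite F" "0 \<le> M" "\<And>i. i \<in> F \<Longrightarrow> norm (a i) \<le> M" for F a M
  proof -
    have "(MAX i. norm (if i \<in> F then a i else 0)) \<le> M"
      using that trunc(3)[OF that(1)] by (subst Max_le_iff) auto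
    moreover have "norm (\<Sum>i\<in>F. sc (a i) (s i)) \<le> C * (MAX i. norm (if i \<in> F then a i else 0))"
      using bd(2)[OF trunc(1)[OF that(1)]] trunc(2)[OF that(1)] by simp
    ultimately show ?thesis
      using c by (meson mult_left_mono order_trans less_imp_le)
  qed
  have low: "c * norm (a i) \<le> norm (\<Sum>i\<in>F. sc (a i) (s i))"
    if "finite F" "i \<in> F" for F a i
  proof -
    have "norm (a i) \<le> (MAX i. norm (if i \<in> F then a i else 0))"
      using that trunc(3)[OF that(1)]
      by (intro Max_ge) (auto intro!: image_eqI[where x = i])
    moreover have "c * (MAX i. norm (if i \<in> F then a i else 0)) \<le> norm (\<Sum>i\<in>F. sc (a i) (s i))"
      using bd(1)[OF trunc(1)[OF that(1)]] trunc(2)[OF that(1)] by simp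
    ultimately show ?thesis
      using c by (meson mult_left_mono order_trans less_imp_le)
  qed
  define V where "V = {b :: nat \<Rightarrow> 'k. b \<longlonglongrightarrow> 0}"
  define T where "T b = (\<Sum>i. sc (b i) (s i))" for b
  have smb: "summable (\<lambda>i. sc (b i) (s i))" if bV: "b \<in> V" for b
    unfolding summable_Cauchy
  proof (intro allI impI)
    fix e :: real assume e: "0 < e"
    define d where "d = e / (2 * C)"
    have d: "0 < d" "C * d < e" using e c by (auto simp: d_def field_simps)
    obtain M where M: "\<And>i. i \<ge> M \<Longrightarrow> norm (b i) < d"
      using bV d(1) unfolding V_def LIMSEQ_iff by auto
    have "norm (\<Sum>i\<in>{m..<n}. sc (b i) (s i)) < e" if "m \<ge> M" for m n
    proof -
      have "norm (\<Sum>i\<in>{m..<n}. sc (b i) (s i)) \<le> C * d"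
        using M that d by (intro up) (auto intro!: less_imp_le)
      then show ?thesis using d by simp
    qed
    then show "\<exists>N. \<forall>m\<ge>N. \<forall>n. norm (\<Sum>i\<in>{m..<n}. sc (b i) (s i)) < e" by blast
  qed
  have lim: "(\<lambda>n. norm (\<Sum>i<n. sc (b i) (s i))) \<longlonglongrightarrow> norm (T b)" if "b \<in> V" for b
    unfolding T_def using summable_LIMSEQ[OF smb[OF that]] by (rule tendsto_norm)
  have upT: "norm (T b) \<le> C * M" if "b \<in> V" "0 \<le> M" "\<And>i. norm (b i) \<le> M" for b M
    using lim[OF that(1)] by (rule LIMSEQ_le_const2) (use up that in auto)
  have lowT: "c * norm (b i) \<le> norm (T b)" if "b \<in> V" for b i
    using lim[OF that]
  proof (rule LIMSEQ_le_const)
    show "\<exists>N. \<forall>n\<ge>N. c * norm (b i) \<le> norm (\<Sum>i<n. sc (b i) (s i))"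
      using low by (intro exI[of _ "Suc i"]) auto
  qed
  have scV: "seq_scale k b \<in> V" if "b \<in> V" for k b
    using that tendsto_mult_right_zero[of b sequentially k] by (auto simp: V_def seq_scale_def)
  have addV: "b + b' \<in> V" if "b \<in> V" "b' \<in> V" for b b'
    using that tendsto_add[of b 0 sequentially b' 0] by (auto simp: V_def plus_fun_def)
  have diffV: "b - b' \<in> V" if "b \<in> V" "b' \<in> V" for b b'
    using that tendsto_diff[of b 0 sequentially b' 0] by (auto simp: V_def fun_diff_def)
  have zeroV: "0 \<in> V" by (simp add: V_def zero_fun_def)
  have Tadd: "T (b + b') = T b + T b'" if "b \<in> V" "b' \<in> V" for b b'
    unfolding T_def using suminf_add[OF smb[OF that(1)] smb[OF that(2)]]
    by (simp add: scale_left_distrib)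
  have bl: "bounded_linear (sc k)" for k
  proof (rule bounded_linear_intro[where K = "norm k"])
    fix v w r
    show "sc k (v + w) = sc k v + sc k w" by (rule scale_right_distrib)
    show "sc k (r *\<^sub>R v) = r *\<^sub>R sc k v"
      by (simp add: scale_of_real[symmetric] mult.commute)
    show "norm (sc k v) \<le> norm v * norm k" by (simp add: norm_scale)
  qed
  have Tsc: "T (seq_scale k b) = sc k (T b)" if "b \<in> V" for k b
    unfolding T_def using bounded_linear.suminf[OF bl smb[OF that]]
    by (simp add: seq_scale_def)
  have T0: "T 0 = 0" by (simp add: T_def)
  interpret S: vector_space "seq_scale :: 'k \<Rightarrow> _" by (rule vector_space_seq_scale)
  have ban: "banach_space_on seq_scale V (\<lambda>b. norm (T b))"
  proof unfold_locales
    show "S.subspace V" by (simp add: S.subspace_def zeroV addV scV)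
  next
    fix v assume v: "v \<in> V"
    show "norm (T v) = 0 \<longleftrightarrow> v = 0"
    proof
      assume "norm (T v) = 0"
      then have "c * norm (v i) \<le> 0" for i using lowT[OF v, of i] by simp
      then have "v i = 0" for i using c by (simp add: mult_le_0_iff)
      then show "v = 0" by (simp add: fun_eq_iff)
    qed (simp add: T0)
  next
    fix u :: "nat \<Rightarrow> nat \<Rightarrow> 'k"
    assume u: "range u \<subseteq> V"
      and Cau: "\<And>e. 0 < e \<Longrightarrow> \<exists>M. \<forall>m\<ge>M. \<forall>n\<ge>M. norm (T (u m - u n)) < e"
    have uV: "u n \<in> V" for n using u by auto
    have unif: "\<exists>M. \<forall>m\<ge>M. \<forall>n\<ge>M. \<forall>j. norm (u m j - u n j) < e" if "0 < e" for e
    proof -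
      obtain M where M: "\<forall>m\<ge>M. \<forall>n\<ge>M. norm (T (u m - u n)) < c * e"
        using Cau[of "c * e"] c \<open>0 < e\<close> by auto
      have "norm (u m j - u n j) < e" if "m \<ge> M" "n \<ge> M" for m n j
      proof -
        have "c * norm ((u m - u n) j) < c * e"
          using lowT[OF diffV[OF uV uV], of m n j] M that by fastforce
        then show ?thesis using c by simp
      qed
      then show ?thesis by blast
    qed
    have "Cauchy (\<lambda>n. u n j)" for j
    proof (rule CauchyI)
      fix e :: real assume "0 < e"
      then show "\<exists>M. \<forall>m\<ge>M. \<forall>n\<ge>M. norm (u m j - u n j) < e" using unif by blast
    qed
    then have "\<forall>j. \<exists>l. (\<lambda>n. u n j) \<longlonglongrightarrow> l"
      by (simp add: Cauchy_convergent_iff convergent_def)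
    then obtain v where v: "\<And>j. (\<lambda>n. u n j) \<longlonglongrightarrow> v j" by metis
    have unifv: "\<exists>M. \<forall>n\<ge>M. \<forall>j. norm (u n j - v j) \<le> e" if "0 < e" for e
    proof -
      obtain M where M: "\<forall>m\<ge>M. \<forall>n\<ge>M. \<forall>j. norm (u m j - u n j) < e" using unif \<open>0 < e\<close> by blast
      have "norm (u n j - v j) \<le> e" if "n \<ge> M" for n j
      proof (rule LIMSEQ_le_const2)
        show "(\<lambda>m. norm (u n j - u m j)) \<longlonglongrightarrow> norm (u n j - v j)"
          by (intro tendsto_intros v)
        show "\<exists>N. \<forall>m\<ge>N. norm (u n j - u m j) \<le> e"
          using M that by (intro exI[of _ M]) (auto intro: less_imp_le)
      qed
      then show ?thesis by blast
    qed
    have "v \<in> V" unfolding V_def LIMSEQ_iff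
    proof (intro CollectI allI impI)
      fix e :: real assume e: "0 < e"
      obtain n where n: "\<forall>j. norm (u n j - v j) \<le> e / 2" using unifv[of "e / 2"] e by auto
      obtain J where J: "\<And>j. j \<ge> J \<Longrightarrow> norm (u n j) < e / 2"
        using uV[of n] half_gt_zero[OF e] unfolding V_def LIMSEQ_iff mem_Collect_eq diff_0_right
        by blast
      have "norm (v j - 0) < e" if "j \<ge> J" for j
      proof -
        have "norm (v j) \<le> norm (u n j) + norm (u n j - v j)"
          by (metis norm_minus_commute norm_triangle_sub)
        then show ?thesis using n[rule_format, of j] J[OF that] by simp
      qed
      then show "\<exists>J. \<forall>j\<ge>J. norm (v j - 0) < e" by blast
    qed
    moreover have "(\<lambda>n. norm (T (u n - v))) \<longlonglongrightarrow> 0"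
      unfolding LIMSEQ_iff
    proof (intro allI impI)
      fix e :: real assume e: "0 < e"
      define d where "d = e / (2 * C)"
      have d: "0 < d" "C * d < e" using e c by (auto simp: d_def field_simps)
      obtain M where M: "\<forall>n\<ge>M. \<forall>j. norm (u n j - v j) \<le> d" using unifv d by blast
      have "norm (norm (T (u n - v)) - 0) < e" if "n \<ge> M" for n
        using upT[OF diffV[OF uV \<open>v \<in> V\<close>], of d n] M that d by fastforce
      then show "\<exists>M. \<forall>n\<ge>M. norm (norm (T (u n - v)) - 0) < e" by blast
    qed
    ultimately show "\<exists>v\<in>V. (\<lambda>n. norm (T (u n - v))) \<longlonglongrightarrow> 0" by blast
  qed (simp_all add: Tsc norm_scale Tadd norm_triangle_ineq)
  define s' :: "nat \<Rightarrow> nat \<Rightarrow> 'k" where "s' = (\<lambda>i j. if j = i then 1 else 0 :: 'k)"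
  show thesis
  proof (rule that[OF ban, of s'])
    show "range s' \<subseteq> V"
    proof (clarsimp simp: V_def s'_def)
      fix i :: nat
      show "(\<lambda>j. if j = i then 1 else 0 :: 'k) \<longlonglongrightarrow> 0"
        by (rule tendsto_eventually)
           (auto simp: eventually_sequentially intro!: exI[of _ "Suc i"])
    qed
    fix F :: "nat set" and a :: "nat \<Rightarrow> 'k" assume F: "finite F"
    have "T (\<lambda>j. if j \<in> F then a j else 0) = (\<Sum>j\<in>F. sc (a j) (s j))"
      unfolding T_def by (subst suminf_finite[OF F]) auto
    then show "norm (T (\<Sum>i\<in>F. seq_scale (a i) (s' i))) = norm (\<Sum>i\<in>F. sc (a i) (s i))"
      by (simp add: s'_def sum_seq_scale_unit[OF F])
  qed
qed

lemma has_c0_spreading_modelI: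
  fixes sc :: "'k::{real_normed_field, euclidean_space} \<Rightarrow> 'a::real_normed_vector \<Rightarrow> 'a"
    and sc' :: "'k \<Rightarrow> 'b::banach \<Rightarrow> 'b"
  assumes "normed_space_over sc'"
    and "generates_spreading_model sc norm x sc' norm s"
    and "equivalent_c0_basis sc' norm s"
  shows "has_c0_spreading_model sc x"
proof -
  obtain V N and s' :: "nat \<Rightarrow> nat \<Rightarrow> 'k" where
    *: "banach_space_on seq_scale V N" "range s' \<subseteq> V" and
    N: "\<And>F a. finite F \<Longrightarrow> N (\<Sum>i\<in>F. seq_scale (a i) (s' i)) = norm (\<Sum>i\<in>F. sc' (a i) (s i))"
    using c0_realization[OF assms(1,3)] by metis
  have "generates_spreading_model sc norm x seq_scale N s'"
    using assms(2) unfolding generates_spreading_model_def by (simp add: N)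
  moreover have "N (lincomb seq_scale a s') = norm (lincomb sc' a s)" if "a \<in> c00" for a
    unfolding lincomb_def using that by (intro N) (simp add: c00_def)
  then have "equivalent_c0_basis seq_scale N s'"
    using assms(3) unfolding equivalent_c0_basis_def by simp
  ultimately show ?thesis
    unfolding has_c0_spreading_model_def using * by blast
qed

end

theory Submission
  imports Defs
begin

text \<open>
  The additive form of (i) carries everything: for every \<open>\<eta> > 0\<close> some subsequence \<open>y\<close> satisfies
  \<open>\<parallel>w\<parallel> \<le> \<parallel>v\<parallel> + \<eta>\<close> for \<open>v = \<Sum>\<^sub>i a\<^sub>i y\<^sub>i\<close> with \<open>\<bar>a\<^sub>i\<bar> \<le> 1\<close> and its projection
  \<open>w\<close> onto \<open>{..<n} \<union> E\<close> (\<open>additive_projection_bound\<close>). A functional \<open>f\<close> that norms \<open>w\<close>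
  would give this if it were tiny at every other \<open>y\<^sub>j\<close>, and for such an \<open>f\<close> to exist the
  functionals must be chosen coherently. Fix a free ultrafilter \<open>U\<close>. For a fixed list of coefficients
  the norming functional depends on the indices that carry them; taking limits along \<open>U\<close> in the
  last index, then in the last but one, and so on, assigns a functional of norm at most 1 also to each
  pattern of which only an initial part has been placed. When a new index \<open>m\<close> is selected, all finitely
  many functionals assigned so far are small at \<open>x\<^sub>m\<close> for \<open>U\<close>-most \<open>m\<close>, because the
  sequence is weakly null; and if \<open>m\<close> is used to prolong a pattern, the functional changes little
  at the finitely many vectors already passed over, for \<open>U\<close>-most \<open>m\<close>, by the definition of the
  limit. So smallness off the pattern can be preserved for ever (\<open>fusion_along_filter\<close>,
  \<open>near_norming_functionals\<close>). A bound by \<open>(1 + \<epsilon>)\<parallel>v\<parallel>\<close> follows by scaling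
  \<open>max \<bar>a\<^sub>i\<bar>\<close> to 1: the additive bound for two consecutive initial segments itself
  shows that \<open>max \<bar>a\<^sub>i\<bar>\<close> is at most a constant times \<open>\<parallel>v\<parallel>\<close>
  (\<open>schreier_projections_subsequence\<close>).

  For (ii) the same fusion, applied to iterated limits of norms, gives a subsequence along which the
  norms of combinations of \<open>k\<close> far out vectors depend, up to \<open>\<epsilon>\<close>, only on the coefficients
  (\<open>spreading_subsequence\<close>). If the norms of the sums of \<open>k\<close> far out vectors were bounded
  independently of \<open>k\<close>, then convexity would give an upper \<open>c\<^sub>0\<close> estimate, (i) a lower one,
  and the limit of the norms would be a spreading model equivalent to the \<open>c\<^sub>0\<close> basis
  (\<open>has_c0_spreading_model_of_bounded_sums\<close>). Hence these norms are unbounded. By (i) and a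
  pigeonhole argument on the coefficients, a vector with \<open>\<parallel>v\<parallel> \<le> C\<close> and
  \<open>\<bar>a\<^sub>i\<bar> \<le> 1\<close> then has at most \<open>N(\<delta>, C)\<close> coefficients of absolute value at least
  \<open>\<delta>\<close> (\<open>few_large_coefficients\<close>). So \<open>card E\<close> in (ii) is
  bounded in terms of \<open>\<delta>\<^sub>n\<close> and \<open>\<parallel>v\<parallel>\<close>, but \<open>\<parallel>v\<parallel>\<close> is not controlled by \<open>n\<close>. This is repaired by
  applying (i) at a level \<open>N\<close> proportional to \<open>\<parallel>v\<parallel>\<close>: the first \<open>N\<close> terms cost only
  a small multiple of \<open>\<parallel>v\<parallel>\<close>, while \<open>card E\<close> is at most a number that depends on
  \<open>N\<close> alone, which (i) allows (\<open>coefficient_threshold_projections\<close>).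
\<close>

section \<open>Free ultrafilters on the natural numbers\<close>

definition free_ultrafilter :: "nat filter \<Rightarrow> bool" where
  "free_ultrafilter U \<longleftrightarrow>
     U \<noteq> bot \<and> U \<le> sequentially \<and> (\<forall>P. eventually P U \<or> eventually (\<lambda>n. \<not> P n) U)"

text \<open>
  A minimal proper filter below \<open>sequentially\<close> decides every predicate. Zorn's lemma gives one,
  since the infimum of a chain of proper filters is proper.
\<close>

lemma free_ultrafilter_exists: "\<exists>U. free_ultrafilter U"
proof -
  define A :: "nat filter set" where "A = {F. F \<noteq> bot \<and> F \<le> sequentially}"
  define P :: "nat filter \<Rightarrow> nat filter \<Rightarrow> bool" where "P F G \<longleftrightarrow> G \<le> F" for F G
  have "\<exists>m\<in>A. \<forall>a\<in>A. P m a \<longrightarrow> a = m"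
  proof (rule predicate_Zorn)
    show "partial_order_on A (relation_of P A)"
      by (rule partial_order_on_relation_ofI) (auto simp: P_def)
    fix C assume C: "C \<in> Chains (relation_of P A)"
    then have CA: "C \<subseteq> A" and total: "\<And>F G. F \<in> C \<Longrightarrow> G \<in> C \<Longrightarrow> F \<le> G \<or> G \<le> F"
      by (auto simp: Chains_def relation_of_def P_def)
    show "\<exists>u\<in>A. \<forall>a\<in>C. P a u"
    proof (cases "C = {}")
      case True
      then show ?thesis by (auto simp: A_def intro!: exI[of _ sequentially])
    next
      case False
      have "eventually Q (Inf C) \<longleftrightarrow> (\<exists>F\<in>C. eventually Q F)" for Q
        using total by (intro eventually_Inf_base[OF False]) (metis inf.absorb1 inf.absorb2 order_refl)
      then have "Inf C \<noteq> bot"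
        using CA by (auto simp: trivial_limit_def A_def)
      moreover have "Inf C \<le> sequentially"
        using False CA by (auto simp: A_def intro: order_trans[OF Inf_lower])
      ultimately show ?thesis
        by (intro bexI[of _ "Inf C"]) (auto simp: A_def P_def intro: Inf_lower)
    qed
  qed
  then obtain U where U: "U \<in> A" and min: "\<And>F. F \<in> A \<Longrightarrow> F \<le> U \<Longrightarrow> F = U"
    by (auto simp: P_def)
  have "eventually Q U \<or> eventually (\<lambda>n. \<not> Q n) U" for Q
  proof (cases "inf U (principal {n. Q n}) = bot")
    case True
    then have "eventually (\<lambda>n. \<not> Q n) U"
      by (auto simp: trivial_limit_def eventually_inf_principal)
    then show ?thesis ..
  next
    case False
    then have "inf U (principal {n. Q n}) = U"
      using U by (intro min) (auto simp: A_def intro: le_infI1)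
    then have "U \<le> principal {n. Q n}" by (metis inf.cobounded2)
    then show ?thesis by (auto simp: le_principal)
  qed
  then have "free_ultrafilter U" using U by (auto simp: A_def free_ultrafilter_def)
  then show ?thesis ..
qed

lemma free_ultrafilter_bounded_convergent:
  fixes f :: "nat \<Rightarrow> real"
  assumes U: "free_ultrafilter U" and bd: "\<And>n. \<bar>f n\<bar> \<le> B"
  shows "(f \<longlongrightarrow> Lim U f) U"
proof -
  have nb: "U \<noteq> bot" using U by (simp add: free_ultrafilter_def)
  have "compact {-B..B}" by simp
  moreover have "filtermap f U \<noteq> bot" using nb by (simp add: filtermap_bot_iff)
  moreover have "eventually (\<lambda>y. y \<in> {-B..B}) (filtermap f U)"
    using bd by (auto simp: eventually_filtermap abs_le_iff intro!: always_eventually)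
      (smt (verit) bd)
  ultimately obtain l where l: "inf (nhds l) (filtermap f U) \<noteq> bot"
    unfolding compact_filter by blast
  have "(f \<longlongrightarrow> l) U"
    unfolding tendsto_def
  proof (intro allI impI)
    fix S assume S: "open S" "l \<in> S"
    show "eventually (\<lambda>n. f n \<in> S) U"
    proof (rule ccontr)
      assume "\<not> eventually (\<lambda>n. f n \<in> S) U"
      then have "eventually (\<lambda>n. f n \<notin> S) U"
        using U unfolding free_ultrafilter_def by blast
      then have "eventually (\<lambda>y. y \<notin> S) (filtermap f U)"
        by (simp add: eventually_filtermap)
      moreover have "eventually (\<lambda>y. y \<in> S) (nhds l)"
        using S by (rule eventually_nhds_in_open)
      ultimately have "eventually (\<lambda>y. False) (inf (nhds l) (filtermap f U))"
        unfolding eventually_inf by blast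
      then show False using l by (simp add: trivial_limit_def)
    qed
  qed
  then show ?thesis using tendsto_Lim[OF nb] by metis
qed

section \<open>Norming functionals\<close>

text \<open>
  A minimal sublinear functional is linear; starting below the norm, this gives norming functionals.
  The inequality for positive multiples yields equality, since it applies to the inverse multiple as
  well.
\<close>

definition sublinear :: "('a::real_vector \<Rightarrow> real) \<Rightarrow> bool" where
  "sublinear p \<longleftrightarrow> (\<forall>u v. p (u + v) \<le> p u + p v) \<and> (\<forall>c>0. \<forall>u. p (c *\<^sub>R u) \<le> c * p u)"

lemma sublinear_zero: "p 0 = 0" if "sublinear p"
proof -
  have "p (2 *\<^sub>R 0) \<le> 2 * p 0" "p ((1/2) *\<^sub>R 0) \<le> (1/2) * p 0"
    using that unfolding sublinear_def by (metis zero_less_numeral, metis half_gt_zero_iff zero_less_one)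
  then show ?thesis by simp
qed

lemma sublinear_uminus: "- p (- v) \<le> p v" if "sublinear p"
proof -
  have "p (v + - v) \<le> p v + p (- v)"
    using that unfolding sublinear_def by blast
  then show ?thesis using sublinear_zero[OF that] by simp
qed

text \<open>
  Zorn's lemma applies because a chain of sublinear functionals below \<open>p\<close> is bounded below
  by \<open>- p (- v)\<close> at every \<open>v\<close>, so its pointwise infimum exists and is sublinear.
\<close>

lemma minimal_sublinear_exists:
  fixes p :: "'a::real_vector \<Rightarrow> real"
  assumes p: "sublinear p"
  shows "\<exists>q. sublinear q \<and> q \<le> p \<and> (\<forall>q'. sublinear q' \<longrightarrow> q' \<le> q \<longrightarrow> q' = q)"
proof -
  define A where "A = {q. sublinear q \<and> q \<le> p}"
  define P :: "('a \<Rightarrow> real) \<Rightarrow> ('a \<Rightarrow> real) \<Rightarrow> bool" where "P F G \<longleftrightarrow> G \<le> F" for F G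
  have "\<exists>m\<in>A. \<forall>a\<in>A. P m a \<longrightarrow> a = m"
  proof (rule predicate_Zorn)
    show "partial_order_on A (relation_of P A)"
      by (rule partial_order_on_relation_ofI) (auto simp: P_def)
    fix C assume C: "C \<in> Chains (relation_of P A)"
    then have CA: "C \<subseteq> A" and total: "\<And>F G. F \<in> C \<Longrightarrow> G \<in> C \<Longrightarrow> F \<le> G \<or> G \<le> F"
      by (auto simp: Chains_def relation_of_def P_def)
    show "\<exists>u\<in>A. \<forall>a\<in>C. P a u"
    proof (cases "C = {}")
      case True
      then show ?thesis using p by (auto simp: A_def)
    next
      case ne: False
      define u where "u v = (INF q\<in>C. q v)" for v
      have low: "- p (- v) \<le> q v" if "q \<in> C" for q v
      proof -
        have "q (- v) \<le> p (- v)" "sublinear q" using that CA by (auto simp: A_def le_fun_def)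
        then show ?thesis using sublinear_uminus[of q v] by linarith
      qed
      have bdd: "bdd_below ((\<lambda>q. q v) ` C)" for v
        using low by (auto simp: bdd_below_def)
      have ule: "u v \<le> q v" if "q \<in> C" for q v
        unfolding u_def by (rule cINF_lower[OF bdd that])
      have geI: "x \<le> u v" if "\<And>q. q \<in> C \<Longrightarrow> x \<le> q v" for x v
        unfolding u_def using ne that by (rule cINF_greatest)
      have sumle: "u (v + w) \<le> q v + q' w" if "q \<in> C" "q' \<in> C" for v w q q'
      proof -
        have *: "u (v + w) \<le> r v + r w" if "r \<in> C" for r
        proof -
          have "u (v + w) \<le> r (v + w)" "sublinear r" using ule CA that by (auto simp: A_def)
          then show ?thesis by (meson order_trans sublinear_def)
        qed
        show ?thesis
          using total[OF that]
        proof
          assume "q \<le> q'"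
          then show ?thesis using *[OF that(1)] le_funD[of q q' w] by linarith
        next
          assume "q' \<le> q"
          then show ?thesis using *[OF that(2)] le_funD[of q' q v] by linarith
        qed
      qed
      have "u (v + w) \<le> u v + u w" for v w
      proof -
        have "u (v + w) - q v \<le> u w" if "q \<in> C" for q
          using sumle[OF that] by (intro geI) (simp add: diff_le_eq add.commute)
        then have "u (v + w) - u w \<le> u v"
          by (intro geI) (smt (verit))
        then show ?thesis by simp
      qed
      moreover have "u (c *\<^sub>R v) \<le> c * u v" if "c > 0" for c v
      proof -
        have "u (c *\<^sub>R v) / c \<le> u v"
        proof (rule geI)
          fix q assume q: "q \<in> C"
          then have "q (c *\<^sub>R v) \<le> c * q v"
            using CA \<open>c > 0\<close> by (auto simp: A_def sublinear_def)
          then show "u (c *\<^sub>R v) / c \<le> q v"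
            using ule[OF q, of "c *\<^sub>R v"] that by (simp add: divide_le_eq mult.commute)
        qed
        then show ?thesis using that by (simp add: divide_le_eq mult.commute)
      qed
      ultimately have "sublinear u" by (simp add: sublinear_def)
      moreover have "u \<le> p"
      proof -
        obtain q where "q \<in> C" using ne by blast
        then have "u \<le> q" "q \<le> p" using ule CA by (auto simp: le_fun_def A_def)
        then show ?thesis by simp
      qed
      ultimately show ?thesis
        using ule by (intro bexI[of _ u]) (auto simp: A_def P_def le_fun_def)
    qed
  qed
  then obtain q where q: "q \<in> A" "\<forall>a\<in>A. P q a \<longrightarrow> a = q" by blast
  then have "sublinear q" "q \<le> p" by (auto simp: A_def)
  moreover have "q' = q" if "sublinear q'" "q' \<le> q" for q'
    using q that \<open>q \<le> p\<close> by (auto simp: A_def P_def)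
  ultimately show ?thesis by blast
qed

text \<open>
  The witness is \<open>w \<mapsto> INF t\<ge>0. q (w + t v) - t q v\<close>. Minimality of \<open>q\<close> makes it equal to \<open>q\<close>,
  so that \<open>q (- v) = - q v\<close>; for \<open>q\<close> the norm, it is the starting point of a functional that
  norms \<open>v\<close>.
\<close>

lemma sublinear_tilt:
  fixes q :: "'a::real_vector \<Rightarrow> real"
  assumes q: "sublinear q"
  obtains q' where "sublinear q'" "q' \<le> q" "q' (- v) \<le> - q v"
proof -
  have add: "q (x + y) \<le> q x + q y" and hom: "c > 0 \<Longrightarrow> q (c *\<^sub>R x) \<le> c * q x" for x y c
    using q by (auto simp: sublinear_def)
  define h where "h w t = q (w + t *\<^sub>R v) - t * q v" for w t
  define q' where "q' w = (INF t\<in>{0..}. h w t)" for w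
  have "- q (- w) \<le> h w t" if "0 \<le> t" for w t
  proof -
    have "t * q v \<le> q (t *\<^sub>R v)"
    proof (cases "t = 0")
      case False
      then have "q ((1/t) *\<^sub>R (t *\<^sub>R v)) \<le> (1/t) * q (t *\<^sub>R v)" using that by (intro hom) auto
      then show ?thesis using False that by (simp add: field_simps)
    qed (simp add: sublinear_zero[OF q])
    also have "\<dots> \<le> q (w + t *\<^sub>R v) + q (- w)"
      using add[of "w + t *\<^sub>R v" "- w"] by simp
    finally show ?thesis by (simp add: h_def)
  qed
  then have bdd: "bdd_below (h w ` {0..})" for w
    by (auto simp: bdd_below_def)
  have le: "q' w \<le> h w t" if "0 \<le> t" for w t
    unfolding q'_def using that by (intro cINF_lower bdd) auto
  have geI: "x \<le> q' w" if "\<And>t. 0 \<le> t \<Longrightarrow> x \<le> h w t" for x w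
    unfolding q'_def using that by (intro cINF_greatest) auto
  have "q' (w + z) \<le> q' w + q' z" for w z
  proof -
    have "q' (w + z) \<le> h w t + h z s" if "0 \<le> t" "0 \<le> s" for t s
      using le[of "t + s" "w + z"] that add[of "w + t *\<^sub>R v" "z + s *\<^sub>R v"]
      by (simp add: h_def algebra_simps)
    then have "q' (w + z) - h w t \<le> q' z" if "0 \<le> t" for t
      using that by (intro geI) (simp add: diff_le_eq add.commute)
    then have "q' (w + z) - q' z \<le> q' w"
      by (intro geI) (smt (verit))
    then show ?thesis by simp
  qed
  moreover have "q' (c *\<^sub>R w) \<le> c * q' w" if "c > 0" for c w
  proof -
    have "q' (c *\<^sub>R w) / c \<le> q' w"
    proof (rule geI)
      fix t :: real assume t: "0 \<le> t"
      have "q' (c *\<^sub>R w) \<le> h (c *\<^sub>R w) (c * t)" using t that by (intro le) auto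
      also have "\<dots> \<le> c * h w t"
        using hom[OF that, of "w + t *\<^sub>R v"] by (simp add: h_def algebra_simps)
      finally show "q' (c *\<^sub>R w) / c \<le> h w t" using that by (simp add: divide_le_eq mult.commute)
    qed
    then show ?thesis using that by (simp add: divide_le_eq mult.commute)
  qed
  ultimately have "sublinear q'" by (simp add: sublinear_def)
  moreover have "q' \<le> q" using le[of 0] by (auto simp: le_fun_def h_def)
  moreover have "q' (- v) \<le> - q v" using le[of 1 "- v"] by (simp add: h_def sublinear_zero[OF q])
  ultimately show thesis by (rule that)
qed

lemma norming_functional_exists:
  fixes u :: "'a::real_normed_vector"
  shows "\<exists>f. linear f \<and> (\<forall>v. \<bar>f v\<bar> \<le> norm v) \<and> f u = norm u"
proof -
  have "sublinear (norm :: 'a \<Rightarrow> real)" by (simp add: sublinear_def norm_triangle_ineq)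
  then obtain p :: "'a \<Rightarrow> real" where p: "sublinear p" "p \<le> norm" "p (- u) \<le> - norm u"
    by (rule sublinear_tilt)
  obtain f where f: "sublinear f" "f \<le> p" and min: "\<And>q. sublinear q \<Longrightarrow> q \<le> f \<Longrightarrow> q = f"
    using minimal_sublinear_exists[OF p(1)] by blast
  have add: "f (x + y) \<le> f x + f y" and hom: "c > 0 \<Longrightarrow> f (c *\<^sub>R x) \<le> c * f x" for x y c
    using f(1) by (auto simp: sublinear_def)
  have odd: "f (- v) = - f v" for v
  proof -
    obtain q where "sublinear q" "q \<le> f" "q (- v) \<le> - f v" using sublinear_tilt[OF f(1)] by metis
    then have "f (- v) \<le> - f v" using min by metis
    moreover have "- f (- (- v)) \<le> f (- v)" by (rule sublinear_uminus[OF f(1)])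
    ultimately show ?thesis by simp
  qed
  have "linear f"
  proof (rule linearI)
    fix v w
    show "f (v + w) = f v + f w"
      using add[of v w] add[of "- v" "- w"] odd[of "v + w"] odd[of v] odd[of w] by simp
  next
    fix c v
    have pos: "f (c *\<^sub>R v) = c * f v" if "c > 0" for c v
    proof -
      have "f ((1/c) *\<^sub>R (c *\<^sub>R v)) \<le> (1/c) * f (c *\<^sub>R v)" using that by (intro hom) auto
      then have "c * f v \<le> f (c *\<^sub>R v)" using that by (simp add: field_simps)
      then show ?thesis using hom[OF that, of v] by simp
    qed
    show "f (c *\<^sub>R v) = c *\<^sub>R f v"
    proof (cases c "0::real" rule: linorder_cases)
      case less
      then show ?thesis using pos[of "- c" v] odd[of "c *\<^sub>R v"] by simp
    next
      case equal
      then show ?thesis by (simp add: sublinear_zero[OF f(1)])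
    next
      case greater
      then show ?thesis using pos by simp
    qed
  qed
  moreover have le: "f v \<le> norm v" for v
    using f(2) p(2) by (meson le_funD order_trans)
  then have "\<bar>f v\<bar> \<le> norm v" for v
    using le[of v] le[of "- v"] odd[of v] by (simp add: abs_le_iff)
  moreover have "f (- u) \<le> - norm u" using f(2) p(3) by (meson le_funD order_trans)
  then have "f u = norm u" using odd[of u] le[of u] by simp
  ultimately show ?thesis by blast
qed

section \<open>Weak convergence against real functionals\<close>

context normed_space_over
begin

lemma scaleR_eq: "sc (r *\<^sub>R c) v = r *\<^sub>R sc c v"
proof -
  have "r *\<^sub>R c = of_real r * c" by (simp add: scaleR_conv_of_real)
  then show ?thesis by (metis scale_of_real scale_scale)
qed

lemma scale_scaleR: "sc c (r *\<^sub>R v) = r *\<^sub>R sc c v"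
  by (simp add: scale_of_real[symmetric] mult.commute)

lemma scale_Basis_expansion: "sc t v = (\<Sum>b\<in>Basis. (t \<bullet> b) *\<^sub>R sc b v)"
proof -
  have "sc (\<Sum>b\<in>Basis. (t \<bullet> b) *\<^sub>R b) v = (\<Sum>b\<in>Basis. (t \<bullet> b) *\<^sub>R sc b v)"
    by (simp add: scale_sum_left scaleR_eq)
  then show ?thesis by (simp only: euclidean_representation)
qed

lemma functional_scale_Basis: "f (sc t v) = (\<Sum>b\<in>Basis. (t \<bullet> b) * f (sc b v))" if "linear f"
  by (subst scale_Basis_expansion) (simp add: linear_sum[OF that] linear_cmul[OF that])

text \<open>
  Weak nullity speaks of functionals with values in the scalar field, while norming functionals are
  real valued. The real functional \<open>\<tau> c = c \<bullet> 1\<close> on the field is nonzero, so \<open>c \<mapsto> \<tau> (c \<cdot> _)\<close> is an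
  injective, hence bijective, linear map from the field to its real dual. Every real functional \<open>f\<close>
  is therefore of the form \<open>f v = \<tau> (g v)\<close> with \<open>g\<close> linear over the field.
\<close>

lemma weakly_null_real_functional:
  fixes f :: "'a \<Rightarrow> real"
  assumes wn: "weakly_null sc x" and lin: "linear f" and bd: "\<And>v. \<bar>f v\<bar> \<le> norm v"
  shows "(\<lambda>n. f (sc t (x n))) \<longlonglongrightarrow> 0"
proof -
  \<comment> \<open>\<open>A c\<close> represents the real functional \<open>k \<mapsto> (c * k) \<bullet> 1\<close> by the inner product.\<close>
  define A :: "'k \<Rightarrow> 'k" where "A c = (\<Sum>b\<in>Basis. ((c * b) \<bullet> 1) *\<^sub>R b)" for c
  have A: "A c \<bullet> k = (c * k) \<bullet> 1" for c k
  proof -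
    have "linear (\<lambda>k. (c * k) \<bullet> 1)" by (rule linearI) (simp_all add: algebra_simps)
    then have "(c * (\<Sum>b\<in>Basis. (k \<bullet> b) *\<^sub>R b)) \<bullet> 1 = (\<Sum>b\<in>Basis. (k \<bullet> b) * ((c * b) \<bullet> 1))"
      using linear_sum[of "\<lambda>k. (c * k) \<bullet> 1" "\<lambda>b. (k \<bullet> b) *\<^sub>R b" Basis]
      by (simp add: linear_cmul)
    then have "(c * k) \<bullet> 1 = (\<Sum>b\<in>Basis. (k \<bullet> b) * ((c * b) \<bullet> 1))"
      by (simp only: euclidean_representation)
    then show ?thesis
      unfolding A_def inner_sum_left inner_scaleR_left by (simp add: inner_commute mult.commute)
  qed
  have linA: "linear A"
    by (rule linearI)
      (simp_all add: A_def distrib_right inner_add_left scaleR_left_distrib sum.distrib scaleR_sum_right)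
  have "inj A"
    unfolding linear_injective_0[OF linA]
  proof (intro allI impI, rule ccontr)
    fix c assume "A c = 0" "c \<noteq> 0"
    then have "(1::'k) \<bullet> 1 = 0" using A[of c "inverse c"] by simp
    then show False by simp
  qed
  then obtain A' where A': "linear A'" "\<And>c. A (A' c) = c"
    using linear_injective_isomorphism[OF linA] by blast
  \<comment> \<open>\<open>w v\<close> represents the real functional \<open>k \<mapsto> f (sc k v)\<close> in the same way.\<close>
  define w where "w v = (\<Sum>b\<in>Basis. f (sc b v) *\<^sub>R b)" for v
  have w: "w v \<bullet> k = f (sc k v)" for v k
  proof -
    show ?thesis
      unfolding w_def inner_sum_left inner_scaleR_left functional_scale_Basis[OF lin, of k]
      by (simp add: inner_commute mult.commute)
  qed
  define g where "g v = A' (w v)" for v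
  have g: "(g v * k) \<bullet> 1 = f (sc k v)" for v k
    using A[of "g v" k] by (simp add: g_def A' w)
  have uniq: "c = d" if "\<And>k. (c * k) \<bullet> 1 = (d * k) \<bullet> 1" for c d :: 'k
  proof -
    have "A c = A d" using that by (simp add: A_def)
    then show ?thesis using \<open>inj A\<close> by (simp add: inj_eq)
  qed
  have "Vector_Spaces.linear sc (*) g"
  proof (rule Vector_Spaces.linear.intro)
    show "vector_space sc" ..
    show "vector_space ((*) :: 'k \<Rightarrow> _)" by unfold_locales (simp_all add: algebra_simps)
    show "module_hom sc (*) g"
    proof (unfold_locales)
      show "g (u + v) = g u + g v" for u v
        by (rule uniq) (simp add: g distrib_right inner_add_left scale_right_distrib linear_add[OF lin])
      show "g (sc c v) = c * g v" for c v
      proof (rule uniq)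
        fix k
        have "(c * g v * k) \<bullet> 1 = (g v * (k * c)) \<bullet> 1" by (simp add: ac_simps)
        then show "(g (sc c v) * k) \<bullet> 1 = (c * g v * k) \<bullet> 1" by (simp only: g) simp
      qed
    qed
  qed
  moreover have "\<exists>B. \<forall>v. norm (g v) \<le> B * norm v"
  proof -
    obtain K where K: "\<And>c. norm (A' c) \<le> K * norm c" "0 \<le> K"
      using linear_bounded_pos[OF A'(1)] by (metis less_imp_le)
    have "norm (w v) \<le> real DIM('k) * norm v" for v
    proof -
      have "norm (w v) \<le> (\<Sum>b\<in>(Basis::'k set). norm v)"
        unfolding w_def using bd by (intro sum_norm_le) (metis mult.left_neutral mult.right_neutral norm_Basis norm_scale norm_scaleR real_norm_def)
      then show ?thesis by simp
    qed
    then have "norm (g v) \<le> K * (real DIM('k) * norm v)" for v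
      unfolding g_def using K by (meson mult_left_mono order_trans)
    then show ?thesis by (metis mult.assoc)
  qed
  ultimately have "(\<lambda>n. g (x n)) \<longlonglongrightarrow> 0" using wn unfolding weakly_null_def by blast
  then have "(\<lambda>n. (g (x n) * t) \<bullet> 1) \<longlonglongrightarrow> (0 * t) \<bullet> 1" by (intro tendsto_intros)
  then show ?thesis by (simp add: g)
qed

lemma functional_scale_le:
  fixes f :: "'a \<Rightarrow> real"
  assumes "linear f" "\<And>b. b \<in> Basis \<Longrightarrow> \<bar>f (sc b v)\<bar> \<le> e" "norm t \<le> 1"
  shows "\<bar>f (sc t v)\<bar> \<le> real DIM('k) * e"
proof -
  have "\<bar>f (sc t v)\<bar> \<le> (\<Sum>b\<in>(Basis::'k set). e)"
    unfolding functional_scale_Basis[OF assms(1), of t]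
  proof (rule order_trans[OF sum_abs], rule sum_mono)
    fix b :: 'k assume b: "b \<in> Basis"
    have "\<bar>t \<bullet> b\<bar> \<le> 1" using Basis_le_norm[OF b, of t] assms(3) by linarith
    then have "\<bar>t \<bullet> b\<bar> * \<bar>f (sc b v)\<bar> \<le> 1 * e"
      using assms(2)[OF b] by (intro mult_mono) auto
    then show "\<bar>(t \<bullet> b) * f (sc b v)\<bar> \<le> e" by (simp add: abs_mult)
  qed
  then show ?thesis by simp
qed

lemma norm_lincomb_diff_le:
  assumes "\<And>i. i \<in> E \<Longrightarrow> norm (a i - b i) \<le> e" "\<And>i. i \<in> E \<Longrightarrow> norm (v i) \<le> B" "0 \<le> e"
  shows "norm ((\<Sum>i\<in>E. sc (a i) (v i)) - (\<Sum>i\<in>E. sc (b i) (v i))) \<le> real (card E) * (e * B)"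
proof -
  have "norm (\<Sum>i\<in>E. sc (a i - b i) (v i)) \<le> (\<Sum>i\<in>E. e * B)"
  proof (rule sum_norm_le)
    fix i assume "i \<in> E"
    then show "norm (sc (a i - b i) (v i)) \<le> e * B"
      using assms by (auto simp: norm_scale intro!: mult_mono)
  qed
  then show ?thesis by (simp add: sum_subtractf scale_left_diff_distrib)
qed

lemma lincomb_eq_sum:
  assumes "finite F" "\<And>i. a i \<noteq> 0 \<Longrightarrow> i \<in> F"
  shows "lincomb sc a y = (\<Sum>i\<in>F. sc (a i) (y i))"
  unfolding lincomb_def using assms by (intro sum.mono_neutral_left) auto

end

section \<open>Iterated limits along an ultrafilter\<close>

text \<open>
  A finite requirement \<open>Q k\<close> on the first \<open>k\<close> terms that survives almost every choice of
  the next term can be kept for ever. Replacing \<open>r k\<close> in a total function avoids partial sequences;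
  the locality hypothesis says that the values beyond are junk.
\<close>

lemma fusion_along_filter:
  fixes Q :: "nat \<Rightarrow> (nat \<Rightarrow> nat) \<Rightarrow> bool"
  assumes nb: "U \<noteq> bot" and free: "U \<le> sequentially"
    and base: "\<And>r. Q 0 r"
    and step: "\<And>k r. Q k r \<Longrightarrow> eventually (\<lambda>m. Q (Suc k) (r(k := m))) U"
    and loc: "\<And>k r r'. (\<And>i. i < k \<Longrightarrow> r i = r' i) \<Longrightarrow> Q k r \<Longrightarrow> Q k r'"
  obtains r where "strict_mono r" "\<And>k. Q k r"
proof -
  have "\<exists>R. \<forall>k. Q k (R k) \<and> (\<exists>m. R (Suc k) = (R k)(k := m) \<and> (\<forall>i<k. R k i < m))"
  proof (rule dependent_nat_choice)
    fix r k assume "Q k r"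
    then have ev: "eventually (\<lambda>m. Q (Suc k) (r(k := m))) U" by (rule step)
    have "eventually (\<lambda>m. \<forall>i\<in>{..<k}. r i < m) sequentially"
      by (intro eventually_ball_finite) (auto intro: eventually_gt_at_top)
    then have "eventually (\<lambda>m. \<forall>i\<in>{..<k}. r i < m) U"
      using free by (rule filter_leD[rotated])
    with ev have "eventually (\<lambda>m. Q (Suc k) (r(k := m)) \<and> (\<forall>i\<in>{..<k}. r i < m)) U"
      by (rule eventually_conj)
    then obtain m where "Q (Suc k) (r(k := m))" "\<forall>i\<in>{..<k}. r i < m"
      using eventually_happens'[OF nb] by blast
    then show "\<exists>s. Q (Suc k) s \<and> (\<exists>m. s = r(k := m) \<and> (\<forall>i<k. r i < m))" by auto
  qed (use base in blast)
  then obtain R where R: "\<And>k. Q k (R k)"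
    "\<And>k. \<exists>m. R (Suc k) = (R k)(k := m) \<and> (\<forall>i<k. R k i < m)" by blast
  define r where "r k = R (Suc k) k" for k
  have RS: "R (Suc k) = (R k)(k := r k)" "i < k \<Longrightarrow> R k i < r k" for k i
    using R(2)[of k] by (auto simp: r_def)
  have Rr: "R k i = r i" if "i < k" for k i
    using that by (induction k) (auto simp: RS(1) less_Suc_eq)
  have "r k < r (Suc k)" for k
    using RS(2)[of k "Suc k"] Rr[of k "Suc k"] by simp
  then have "strict_mono r" by (simp add: strict_mono_Suc_iff)
  moreover have "Q k r" for k
    using R(1) by (rule loc[rotated]) (simp add: Rr)
  ultimately show thesis by (rule that)
qed

definition norming_functional :: "'a::real_normed_vector \<Rightarrow> 'a \<Rightarrow> real" where
  "norming_functional u = (SOME f. linear f \<and> (\<forall>v. \<bar>f v\<bar> \<le> norm v) \<and> f u = norm u)"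

lemma norming_functional:
  "linear (norming_functional u)" "\<bar>norming_functional u v\<bar> \<le> norm v"
  "norming_functional u u = norm u"
  using someI_ex[OF norming_functional_exists[of u]] unfolding norming_functional_def by auto

lemma unit_ball_finite_net:
  assumes "0 < e"
  obtains Z :: "'k::{real_normed_field, euclidean_space} set"
  where "finite Z" "\<And>t. norm t \<le> 1 \<Longrightarrow> \<exists>z\<in>Z. norm (t - z) < e"
proof -
  have "compact (cball 0 1 :: 'k set)" by simp
  then obtain Z where "finite Z" "(cball 0 1 :: 'k set) \<subseteq> (\<Union>z\<in>Z. ball z e)"
    using assms by (metis compact_eq_totally_bounded)
  then show thesis
    by (intro that[of Z]) (auto simp: subset_iff dist_norm norm_minus_commute)
qed

text \<open>
  A list of coefficients is attached to a set of indices by the rank of an index, so that one list can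
  be placed on many sets. Conversely any choice of coefficients on a finite set comes from a list.
\<close>

lemma list_along_finite_set:
  fixes E :: "nat set"
  assumes "finite E"
  shows "\<exists>c. length c = card E \<and> set c \<subseteq> h ` E \<and> (\<forall>i\<in>E. c ! card (E \<inter> {..<i}) = h i)"
  using assms
proof (induction E rule: finite_linorder_max_induct)
  case empty
  then show ?case by simp
next
  case (insert k E)
  then obtain c where c: "length c = card E" "set c \<subseteq> h ` E" "\<forall>i\<in>E. c ! card (E \<inter> {..<i}) = h i"
    by blast
  have eq: "insert k E \<inter> {..<i} = E \<inter> {..<i}" if "i \<le> k" for i using that by auto
  have "(c @ [h k]) ! card (insert k E \<inter> {..<i}) = h i" if "i \<in> insert k E" for i
  proof (cases "i = k")
    case True
    moreover have "E \<inter> {..<k} = E" using insert by auto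
    ultimately show ?thesis using c(1) eq[of i] by (simp add: nth_append)
  next
    case False
    then have i: "i \<in> E" "i < k" using that insert by auto
    then have "card (E \<inter> {..<i}) < card E"
      using insert(1) by (intro psubset_card_mono) auto
    then show ?thesis using c i eq[of i] by (simp add: nth_append)
  qed
  moreover have "k \<notin> E" using insert by auto
  ultimately show ?case
    using c insert(1) by (intro exI[of _ "c @ [h k]"]) auto
qed

locale ultralimit_sequence = normed_space_over sc
  for sc :: "'k::{real_normed_field, euclidean_space} \<Rightarrow> 'a::real_normed_vector \<Rightarrow> 'a" +
  fixes x :: "nat \<Rightarrow> 'a" and U :: "nat filter" and B :: real
  assumes U: "free_ultrafilter U" and norm_x_le: "\<And>n. norm (x n) \<le> B"
begin

lemma U_nonbot: "U \<noteq> bot" and U_free: "U \<le> sequentially"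
  using U by (auto simp: free_ultrafilter_def)

lemma B_nonneg: "0 \<le> B"
  using norm_x_le[of 0] norm_ge_zero order_trans by blast

text \<open>
  The list contains the coefficients that have not been placed yet; their indices are sent to infinity
  one after the other, the last one first.
\<close>

primrec iterated_limit :: "('a \<Rightarrow> real) \<Rightarrow> 'k list \<Rightarrow> 'a \<Rightarrow> real" where
  "iterated_limit \<psi> [] u = \<psi> u"
| "iterated_limit \<psi> (t # ts) u = Lim U (\<lambda>m. iterated_limit \<psi> ts (u + sc t (x m)))"

lemma iterated_limit_bound:
  assumes "\<And>u. \<bar>\<psi> u\<bar> \<le> C + norm u"
  shows "\<bar>iterated_limit \<psi> ts u\<bar> \<le> C + norm u + B * (\<Sum>t\<leftarrow>ts. norm t)"
proof (induction ts arbitrary: u)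
  case Nil
  then show ?case using assms by simp
next
  case (Cons t ts)
  let ?g = "\<lambda>m. iterated_limit \<psi> ts (u + sc t (x m))"
  have bd: "\<bar>?g m\<bar> \<le> C + norm u + B * (\<Sum>t\<leftarrow>t # ts. norm t)" for m
  proof -
    have "norm (sc t (x m)) \<le> norm t * B"
      using norm_x_le[of m] by (simp add: norm_scale mult_left_mono)
    then have "norm (u + sc t (x m)) \<le> norm u + norm t * B"
      by (meson add_left_mono norm_triangle_ineq order_trans)
    then show ?thesis using Cons[of "u + sc t (x m)"] by (simp add: algebra_simps)
  qed
  have "((\<lambda>m. \<bar>?g m\<bar>) \<longlongrightarrow> \<bar>Lim U ?g\<bar>) U"
    by (intro tendsto_intros free_ultrafilter_bounded_convergent[OF U bd])
  then show ?case
    unfolding iterated_limit.simps(2)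
    by (rule tendsto_upperbound) (use bd U_nonbot in auto)
qed

lemma iterated_limit_tendsto:
  assumes "\<And>u. \<bar>\<psi> u\<bar> \<le> C + norm u"
  shows "((\<lambda>m. iterated_limit \<psi> ts (u + sc t (x m))) \<longlongrightarrow> iterated_limit \<psi> (t # ts) u) U"
  unfolding iterated_limit.simps(2)
proof (rule free_ultrafilter_bounded_convergent[OF U])
  fix m
  have "norm (sc t (x m)) \<le> norm t * B"
    using norm_x_le[of m] by (simp add: norm_scale mult_left_mono)
  then have "norm (u + sc t (x m)) \<le> norm u + norm t * B"
    by (meson add_left_mono norm_triangle_ineq order_trans)
  then show "\<bar>iterated_limit \<psi> ts (u + sc t (x m))\<bar>
      \<le> C + (norm u + norm t * B) + B * (\<Sum>t\<leftarrow>ts. norm t)"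
    using iterated_limit_bound[OF assms, of ts "u + sc t (x m)"] by simp
qed

text \<open>
  The functional assigned to a pattern whose placed part is the vector \<open>u\<close> and whose remaining
  coefficients are \<open>ts\<close>.
\<close>

definition limit_functional :: "'k list \<Rightarrow> 'a \<Rightarrow> 'a \<Rightarrow> real" where
  "limit_functional ts u v = iterated_limit (\<lambda>w. norming_functional w v) ts u"

lemma limit_functional_Nil: "limit_functional [] u = norming_functional u"
  by (simp add: limit_functional_def fun_eq_iff)

lemma limit_functional_tendsto:
  "((\<lambda>m. limit_functional ts (u + sc t (x m)) v) \<longlongrightarrow> limit_functional (t # ts) u v) U"
  unfolding limit_functional_def
proof (rule iterated_limit_tendsto)
  fix w
  show "\<bar>norming_functional w v\<bar> \<le> norm v + norm w"
    using norming_functional(2)[of w v] norm_ge_zero[of w] by linarith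
qed

lemma limit_functional:
  shows linear_limit_functional: "linear (limit_functional ts u)"
    and limit_functional_le_norm: "\<bar>limit_functional ts u v\<bar> \<le> norm v"
proof (induction ts arbitrary: u v)
  case Nil
  { case 1 show ?case by (simp add: limit_functional_Nil norming_functional) }
  { case 2 show ?case by (simp add: limit_functional_Nil norming_functional) }
next
  case (Cons t ts)
  note lim = limit_functional_tendsto[of ts _ t]
  { case 1
    show ?case
    proof (rule linearI)
      fix v w
      have "((\<lambda>m. limit_functional ts (u + sc t (x m)) (v + w)) \<longlongrightarrow>
          limit_functional (t # ts) u v + limit_functional (t # ts) u w) U"
        unfolding linear_add[OF Cons(1)] by (intro tendsto_intros lim)
      then show "limit_functional (t # ts) u (v + w)
          = limit_functional (t # ts) u v + limit_functional (t # ts) u w"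
        by (rule tendsto_unique[OF U_nonbot lim])
    next
      fix c v
      have "((\<lambda>m. limit_functional ts (u + sc t (x m)) (c *\<^sub>R v)) \<longlongrightarrow>
          c *\<^sub>R limit_functional (t # ts) u v) U"
        unfolding linear_cmul[OF Cons(1)] by (intro tendsto_intros lim)
      then show "limit_functional (t # ts) u (c *\<^sub>R v) = c *\<^sub>R limit_functional (t # ts) u v"
        by (rule tendsto_unique[OF U_nonbot lim])
    qed }
  { case 2
    show ?case
      by (rule tendsto_upperbound[OF tendsto_rabs[OF lim] _ U_nonbot]) (simp add: Cons(2)) }
qed

text \<open>
  The coefficient at \<open>i \<in> E\<close> is the one with the rank of \<open>i\<close> in \<open>E\<close>, so adding a new
  largest index to \<open>E\<close> consumes the next entry of \<open>c\<close> and leaves the other terms alone.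
\<close>

definition pattern_vector :: "(nat \<Rightarrow> nat) \<Rightarrow> 'k list \<Rightarrow> nat set \<Rightarrow> 'a" where
  "pattern_vector r c E = (\<Sum>i\<in>E. sc (c ! card (E \<inter> {..<i})) (x (r i)))"

lemma pattern_vector_cong:
  "(\<And>i. i \<in> E \<Longrightarrow> r i = r' i) \<Longrightarrow> pattern_vector r c E = pattern_vector r' c E"
  by (simp add: pattern_vector_def)

lemma pattern_vector_insert:
  assumes "E \<subseteq> {..<k}"
  shows "pattern_vector r c (insert k E) = pattern_vector r c E + sc (c ! card E) (x (r k))"
proof -
  have fin: "finite E" "k \<notin> E" "insert k E \<inter> {..<k} = E"
    using assms finite_subset by auto
  have "insert k E \<inter> {..<i} = E \<inter> {..<i}" if "i \<in> E" for i using that assms by auto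
  then have "(\<Sum>i\<in>E. sc (c ! card (insert k E \<inter> {..<i})) (x (r i))) = pattern_vector r c E"
    by (simp add: pattern_vector_def)
  then show ?thesis
    using fin by (simp add: pattern_vector_def add.commute)
qed

lemma pattern_vector_update:
  assumes "E \<subseteq> {..<k}"
  shows "pattern_vector (r(k := m)) c E = pattern_vector r c E"
    and "pattern_vector (r(k := m)) c (insert k E) = pattern_vector r c E + sc (c ! card E) (x m)"
proof -
  show *: "pattern_vector (r(k := m)) c E = pattern_vector r c E"
    using assms by (intro pattern_vector_cong) auto
  show "pattern_vector (r(k := m)) c (insert k E) = pattern_vector r c E + sc (c ! card E) (x m)"
    using pattern_vector_insert[OF assms, of "r(k := m)" c] * by simp
qed

section \<open>Projections up to an additive error\<close>

text \<open>
  The requirement \<open>P\<close> is kept for all patterns, complete or not, and all indices that they have passed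
  over. Weak nullity handles a new index outside the pattern, convergence of the iterated limit a new
  index inside it.
\<close>

lemma near_norming_functionals:
  fixes C :: "nat \<Rightarrow> 'k list set" and \<eta> :: "nat \<Rightarrow> real"
  assumes wn: "weakly_null sc x" and fin: "\<And>n. finite (C n)" and pos: "\<And>j. 0 < \<eta> j"
  obtains r where "strict_mono r"
    "\<And>n E c j b. finite E \<Longrightarrow> {..<n} \<subseteq> E \<Longrightarrow> c \<in> C n \<Longrightarrow> card E = length c \<Longrightarrow> j \<notin> E \<Longrightarrow> b \<in> Basis \<Longrightarrow>
       \<bar>norming_functional (pattern_vector r c E) (sc b (x (r j)))\<bar> < \<eta> j"
proof -
  define P where "P r n E c j b \<longleftrightarrow>
      ({..<n} \<subseteq> E \<and> card E \<le> length c \<and> j \<notin> E \<longrightarrow>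
        \<bar>limit_functional (drop (card E) c) (pattern_vector r c E) (sc b (x (r j)))\<bar> < \<eta> j)"
    for r n E c j b
  define Q where "Q k r \<longleftrightarrow>
     (\<forall>n\<in>{..k}. \<forall>E\<in>Pow {..<k}. \<forall>c\<in>C n. \<forall>j\<in>{..<k}. \<forall>b\<in>Basis. P r n E c j b)" for k r
  obtain r where r: "strict_mono r" "\<And>k. Q k r"
  proof (rule fusion_along_filter[OF U_nonbot U_free, of Q])
    show "Q 0 r" for r by (simp add: Q_def)
  next
    fix k and r r' :: "nat \<Rightarrow> nat"
    assume eq: "\<And>i. i < k \<Longrightarrow> r i = r' i" and Q: "Q k r"
    have "P r' n E c j b"
      if "P r n E c j b" "E \<subseteq> {..<k}" "j < k" for n E c j b
    proof -
      have "pattern_vector r c E = pattern_vector r' c E"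
        using that eq by (intro pattern_vector_cong) auto
      then show ?thesis using that eq by (simp add: P_def)
    qed
    then show "Q k r'" using Q by (simp add: Q_def)
  next
    fix k r assume Q: "Q k r"
    have "eventually (\<lambda>m. P (r(k := m)) n E c j b) U"
      if n: "n \<in> {..Suc k}" and E: "E \<in> Pow {..<Suc k}" and c: "c \<in> C n" and j: "j \<in> {..<Suc k}"
        and b: "b \<in> Basis" for n E c j b
    proof (cases "{..<n} \<subseteq> E \<and> card E \<le> length c \<and> j \<notin> E")
      case False
      then have "P (r(k := m)) n E c j b" for m unfolding P_def by blast
      then show ?thesis by simp
    next
      case True
      \<comment> \<open>For \<open>n = Suc k\<close> the pattern contains all indices selected so far, and there is nothing to show.\<close>
      have nk: "n \<le> k"
      proof (rule ccontr)
        assume "\<not> n \<le> k"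
        then have "n = Suc k" using n by simp
        then show False using True j by auto
      qed
      show ?thesis
      proof (cases "k \<in> E")
        case kE: True
        define E' where "E' = E - {k}"
        have E': "E' \<subseteq> {..<k}" "E = insert k E'" "k \<notin> E'" "finite E'"
          using E kE by (auto simp: E'_def less_Suc_eq intro: finite_subset[of _ "{..<Suc k}"])
        have jk: "j < k" "j \<notin> E'" using True kE j E' by (auto simp: less_Suc_eq)
        have card: "card E = Suc (card E')" using E' by simp
        have "{..<n} \<subseteq> E'" using True nk by (auto simp: E'_def)
        then have small: "\<bar>limit_functional (drop (card E') c) (pattern_vector r c E') (sc b (x (r j)))\<bar> < \<eta> j"
          using Q nk E' c b jk True card unfolding Q_def P_def by auto
        have drop: "drop (card E') c = c ! card E' # drop (card E) c"
          using True card by (simp add: Cons_nth_drop_Suc)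
        have "((\<lambda>m. \<bar>limit_functional (drop (card E) c)
                 (pattern_vector r c E' + sc (c ! card E') (x m)) (sc b (x (r j)))\<bar>) \<longlongrightarrow>
               \<bar>limit_functional (drop (card E') c) (pattern_vector r c E') (sc b (x (r j)))\<bar>) U"
          unfolding drop by (intro tendsto_intros limit_functional_tendsto)
        from order_tendstoD(2)[OF this small] show ?thesis
          using jk by (simp add: P_def E'(2) pattern_vector_update(2)[OF E'(1)])
      next
        case False
        then have Ek: "E \<subseteq> {..<k}" using E by (auto simp: less_Suc_eq)
        let ?f = "limit_functional (drop (card E) c) (pattern_vector r c E)"
        show ?thesis
        proof (cases "j = k")
          case jk: True
          have "(\<lambda>m. ?f (sc b (x m))) \<longlonglongrightarrow> 0"
            by (intro weakly_null_real_functional[OF wn] linear_limit_functional limit_functional_le_norm)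
          then have "((\<lambda>m. \<bar>?f (sc b (x m))\<bar>) \<longlongrightarrow> 0) U"
            using U_free tendsto_mono tendsto_rabs_zero by blast
          from order_tendstoD(2)[OF this pos] show ?thesis
            using jk by (simp add: P_def pattern_vector_update(1)[OF Ek])
        next
          case False
          then have "j < k" using j by simp
          then have "P r n E c j b" using Q nk Ek c b by (simp add: Q_def)
          then show ?thesis
            using \<open>j < k\<close> by (simp add: P_def pattern_vector_update(1)[OF Ek])
        qed
      qed
    qed
    then show "eventually (\<lambda>m. Q (Suc k) (r(k := m))) U"
      unfolding Q_def by (intro eventually_ball_finite ballI fin) auto
  qed (rule that)
  show thesis
  proof (rule that[OF r(1)])
    fix n E c j b
    assume *: "finite E" "{..<n} \<subseteq> E" "c \<in> C n" "card E = length c" "j \<notin> E" "b \<in> (Basis::'k set)"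
    have "finite (E \<union> {j})" using *(1) by simp
    then obtain k where k: "E \<union> {j} \<subseteq> {..<k}"
      using finite_nat_iff_bounded by blast
    have "{..<n} \<subseteq> {..<k}" using *(2) k by (meson Un_upper1 order_trans)
    then have "n \<le> k" by simp
    then have "P r n E c j b" using r(2)[of k, unfolded Q_def] k *(3,6) by blast
    then show "\<bar>norming_functional (pattern_vector r c E) (sc b (x (r j)))\<bar> < \<eta> j"
      using * by (simp add: P_def limit_functional_Nil)
  qed
qed

text \<open>
  The coefficients of the projection are replaced by those of a pattern from a finite net, whose mesh
  depends on \<open>n\<close> because up to \<open>n + q n\<close> terms are changed. The functional that norms the pattern
  sees the difference between \<open>v\<close> and its projection only up to a geometric series.
\<close>

lemma additive_projection_bound:
  fixes q :: "nat \<Rightarrow> nat"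
  assumes wn: "weakly_null sc x" and \<eta>: "0 < \<eta>"
  obtains r where "strict_mono r"
    "\<forall>n E. \<forall>a\<in>c00. (\<forall>i. norm (a i) \<le> 1) \<and> finite E \<and> {..<n} \<subseteq> E \<and> card E \<le> n + q n \<longrightarrow>
       norm (\<Sum>i\<in>E. sc (a i) (x (r i))) \<le> norm (lincomb sc a (x \<circ> r)) + \<eta>"
proof -
  define \<theta> where "\<theta> n = \<eta> / (4 * (real (n + q n) + 1) * (B + 1))" for n
  have \<theta>: "0 < \<theta> n" for n using \<eta> B_nonneg by (simp add: \<theta>_def add_pos_nonneg)
  have \<theta>le: "real p * (\<theta> n * B) \<le> \<eta> / 4" if "p \<le> n + q n" for n p
  proof -
    have "real p * B \<le> (real (n + q n) + 1) * (B + 1)"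
      using that B_nonneg by (intro mult_mono) auto
    then have "real p * B * \<eta> \<le> (real (n + q n) + 1) * (B + 1) * \<eta>"
      using \<eta> by (intro mult_right_mono) auto
    moreover have "0 < (real (n + q n) + 1) * (B + 1)" using B_nonneg by (simp add: add_nonneg_pos)
    ultimately show ?thesis by (simp add: \<theta>_def field_simps)
  qed
  have "\<forall>n. \<exists>Z::'k set. finite Z \<and> (\<forall>t. norm t \<le> 1 \<longrightarrow> (\<exists>z\<in>Z. norm (t - z) < \<theta> n))"
    using unit_ball_finite_net[OF \<theta>] by metis
  then obtain Z :: "nat \<Rightarrow> 'k set" where Z: "\<And>n. finite (Z n)"
    "\<And>n t. norm t \<le> 1 \<Longrightarrow> \<exists>z\<in>Z n. norm (t - z) < \<theta> n" by metis
  define C where "C n = {c. set c \<subseteq> Z n \<and> length c \<le> n + q n}" for n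
  \<comment> \<open>Summable to \<open>\<eta> / 2\<close> after losing a factor \<open>DIM('k)\<close> in the passage from basis scalars to all scalars.\<close>
  define \<eta>' where "\<eta>' j = \<eta> / 4 * (1/2)^j / real DIM('k)" for j
  obtain r where r: "strict_mono r" and small:
    "\<And>n E c j b. finite E \<Longrightarrow> {..<n} \<subseteq> E \<Longrightarrow> c \<in> C n \<Longrightarrow> card E = length c \<Longrightarrow> j \<notin> E \<Longrightarrow> b \<in> Basis \<Longrightarrow>
       \<bar>norming_functional (pattern_vector r c E) (sc b (x (r j)))\<bar> < \<eta>' j"
  proof (rule near_norming_functionals[OF wn, of C \<eta>'])
    show "finite (C n)" for n unfolding C_def by (rule finite_lists_length_le[OF Z(1)])
    show "0 < \<eta>' j" for j using \<eta> by (simp add: \<eta>'_def)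
  qed (rule that)
  show thesis
  proof (rule that[OF r], intro allI ballI impI, elim conjE)
    fix n E and a :: "nat \<Rightarrow> 'k"
    assume a: "a \<in> c00" "\<forall>i. norm (a i) \<le> 1" and E: "finite E" "{..<n} \<subseteq> E" "card E \<le> n + q n"
    have "\<forall>i. \<exists>z\<in>Z n. norm (a i - z) < \<theta> n" using Z(2) a(2) by blast
    then obtain h where h: "\<And>i. h i \<in> Z n \<and> norm (a i - h i) < \<theta> n" by metis
    obtain c where c: "length c = card E" "set c \<subseteq> h ` E" "\<forall>i\<in>E. c ! card (E \<inter> {..<i}) = h i"
      using list_along_finite_set[OF E(1), of h] by blast
    have cC: "c \<in> C n" using c E h by (auto simp: C_def)
    define w' where "w' = pattern_vector r c E"
    define w where "w = (\<Sum>i\<in>E. sc (a i) (x (r i)))"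
    define f where "f = norming_functional w'"
    have f: "linear f" "\<And>v. \<bar>f v\<bar> \<le> norm v" "f w' = norm w'"
      unfolding f_def by (rule norming_functional)+
    have "w' = (\<Sum>i\<in>E. sc (h i) (x (r i)))" using c by (simp add: w'_def pattern_vector_def)
    then have "norm (w - w') \<le> real (card E) * (\<theta> n * B)"
      unfolding w_def using h \<theta>[of n] norm_x_le
      by (simp only:) (intro norm_lincomb_diff_le; simp add: less_imp_le)
    also have "\<dots> \<le> \<eta> / 4" by (rule \<theta>le[OF E(3)])
    finally have ww: "norm (w - w') \<le> \<eta> / 4" .
    have "norm w \<le> norm w' + norm (w - w')" by (rule norm_triangle_sub)
    moreover have "f w' \<le> f w + norm (w - w')"
      using f(2)[of "w - w'"] by (simp add: linear_diff[OF f(1)])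
    ultimately have wf: "norm w \<le> f w + \<eta> / 2" using ww f(3) by simp
    define S where "S = {i. a i \<noteq> 0}"
    have S: "finite S" using a by (simp add: S_def c00_def)
    have tail: "\<bar>f (sc (a j) (x (r j)))\<bar> \<le> \<eta> / 4 * (1/2)^j" if "j \<notin> E" for j
    proof -
      have "\<bar>f (sc (a j) (x (r j)))\<bar> \<le> real DIM('k) * \<eta>' j"
      proof (rule functional_scale_le[OF f(1) _ a(2)[rule_format]])
        fix b :: 'k assume "b \<in> Basis"
        then show "\<bar>f (sc b (x (r j)))\<bar> \<le> \<eta>' j"
          unfolding f_def w'_def using small[OF E(1,2) cC c(1)[symmetric] that] by (simp add: less_imp_le)
      qed
      then show ?thesis by (simp add: \<eta>'_def)
    qed
    have "norm (\<Sum>j\<in>S - E. f (sc (a j) (x (r j)))) \<le> (\<Sum>j\<in>S - E. \<eta> / 4 * (1/2)^j)"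
      using tail by (intro sum_norm_le) auto
    also have "\<dots> \<le> (\<Sum>j. \<eta> / 4 * (1/2)^j)"
      using \<eta> S by (intro sum_le_suminf summable_mult summable_geometric) auto
    also have "\<dots> = \<eta> / 2"
      using sums_mult[OF geometric_sums[of "1/2::real"], of "\<eta> / 4"]
      by (intro sums_unique[symmetric]) simp
    finally have rest: "\<bar>\<Sum>j\<in>S - E. f (sc (a j) (x (r j)))\<bar> \<le> \<eta> / 2" by simp
    have "lincomb sc a (x \<circ> r) = (\<Sum>i\<in>E \<union> (S - E). sc (a i) ((x \<circ> r) i))"
      using E S by (intro lincomb_eq_sum) (auto simp: S_def)
    also have "\<dots> = w + (\<Sum>i\<in>S - E. sc (a i) (x (r i)))"
      unfolding w_def using E S by (subst sum.union_disjoint) auto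
    finally have "f (lincomb sc a (x \<circ> r)) = f w + (\<Sum>j\<in>S - E. f (sc (a j) (x (r j))))"
      by (simp add: linear_add[OF f(1)] linear_sum[OF f(1)])
    moreover have "f (lincomb sc a (x \<circ> r)) \<le> norm (lincomb sc a (x \<circ> r))"
      using f(2)[of "lincomb sc a (x \<circ> r)"] by simp
    ultimately show "norm (\<Sum>i\<in>E. sc (a i) (x (r i))) \<le> norm (lincomb sc a (x \<circ> r)) + \<eta>"
      using wf rest unfolding w_def by linarith
  qed
qed

section \<open>Spreading subsequences\<close>

text \<open>
  The Brunel-Sucheston theorem in Cauchy form. The iterated limit \<open>iterated_limit norm c 0\<close> is the
  common value: all partially placed patterns keep their iterated limits within \<open>e n\<close> of it. Patterns
  contained in \<open>{n..}\<close> are considered with at most \<open>n\<close> coefficients from the \<open>n\<close>-th net, so only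
  finitely many requirements are active at a time; the net gets finer with \<open>n\<close> to make up for the
  number of coefficients.
\<close>

lemma spreading_subsequence:
  obtains r :: "nat \<Rightarrow> nat" where "strict_mono r"
    "\<And>k \<epsilon>. 0 < \<epsilon> \<Longrightarrow> \<exists>m::nat. \<forall>n n' (a :: nat \<Rightarrow> 'k). strict_mono_on {..<k} n \<and> strict_mono_on {..<k} n' \<and>
        (\<forall>i<k. m \<le> n i \<and> m \<le> n' i \<and> norm (a i) \<le> 1) \<longrightarrow>
        \<bar>norm (\<Sum>i<k. sc (a i) (x (r (n i)))) - norm (\<Sum>i<k. sc (a i) (x (r (n' i))))\<bar> < \<epsilon>"
proof -
  define e where "e n = 1 / (real n + 1)" for n
  define \<theta> where "\<theta> n = 1 / ((real n + 1) * (real n + 1) * (B + 1))" for n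
  have epos: "0 < e n" for n by (simp add: e_def add_nonneg_pos)
  have \<theta>: "0 < \<theta> n" for n using B_nonneg by (simp add: \<theta>_def add_nonneg_pos)
  have \<theta>le: "real p * (\<theta> n * B) \<le> e n" if "p \<le> n" for n p
  proof -
    have "real p * B \<le> (real n + 1) * (B + 1)"
      using that B_nonneg by (intro mult_mono) auto
    moreover have pos: "0 < real n + 1" "0 < B + 1" using B_nonneg by auto
    ultimately have "real p * B / ((real n + 1) * (B + 1)) \<le> 1" by (simp add: divide_le_eq)
    then have "real p * B / ((real n + 1) * (B + 1)) / (real n + 1) \<le> 1 / (real n + 1)"
      using pos by (intro divide_right_mono) auto
    then show ?thesis by (simp add: \<theta>_def e_def ac_simps)
  qed
  have "\<forall>n. \<exists>Z::'k set. finite Z \<and> (\<forall>t. norm t \<le> 1 \<longrightarrow> (\<exists>z\<in>Z. norm (t - z) < \<theta> n))"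
    using unit_ball_finite_net[OF \<theta>] by metis
  then obtain Z :: "nat \<Rightarrow> 'k set" where Z: "\<And>n. finite (Z n)"
    "\<And>n t. norm t \<le> 1 \<Longrightarrow> \<exists>z\<in>Z n. norm (t - z) < \<theta> n" by metis
  define C where "C n = {c. set c \<subseteq> Z n \<and> length c \<le> n}" for n
  have finC: "finite (C n)" for n unfolding C_def by (rule finite_lists_length_le[OF Z(1)])
  define P where "P r n E c \<longleftrightarrow> (E \<subseteq> {n..} \<and> card E \<le> length c \<longrightarrow>
     \<bar>iterated_limit norm (drop (card E) c) (pattern_vector r c E) - iterated_limit norm c 0\<bar> < e n)"
    for r n E c
  define Q where "Q k r \<longleftrightarrow> (\<forall>n\<in>{..k}. \<forall>E\<in>Pow {..<k}. \<forall>c\<in>C n. P r n E c)" for k r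
  have Pempty: "P r n {} c" for r n c using epos by (simp add: P_def pattern_vector_def)
  obtain r where r: "strict_mono r" "\<And>k. Q k r"
  proof (rule fusion_along_filter[OF U_nonbot U_free, of Q])
    show "Q 0 r" for r using Pempty by (simp add: Q_def)
  next
    fix k and r r' :: "nat \<Rightarrow> nat"
    assume eq: "\<And>i. i < k \<Longrightarrow> r i = r' i" and Q: "Q k r"
    have "pattern_vector r c E = pattern_vector r' c E" if "E \<subseteq> {..<k}" for c E
      using that eq by (intro pattern_vector_cong) auto
    then show "Q k r'" using Q by (simp add: Q_def P_def)
  next
    fix k r assume Q: "Q k r"
    have "eventually (\<lambda>m. P (r(k := m)) n E c) U"
      if n: "n \<in> {..Suc k}" and E: "E \<in> Pow {..<Suc k}" and c: "c \<in> C n" for n E c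
    proof (cases "E \<noteq> {} \<and> E \<subseteq> {n..} \<and> card E \<le> length c")
      case False
      then have "P (r(k := m)) n E c" for m
        using Pempty[of "r(k := m)" n c] unfolding P_def by blast
      then show ?thesis by simp
    next
      case True
      have nk: "n \<le> k" using True E by (force simp: less_Suc_eq)
      show ?thesis
      proof (cases "k \<in> E")
        case kE: True
        define E' where "E' = E - {k}"
        have E': "E' \<subseteq> {..<k}" "E = insert k E'" "k \<notin> E'" "finite E'"
          using E kE by (auto simp: E'_def less_Suc_eq intro: finite_subset[of _ "{..<Suc k}"])
        have card: "card E = Suc (card E')" using E' by simp
        have small: "\<bar>iterated_limit norm (drop (card E') c) (pattern_vector r c E')
            - iterated_limit norm c 0\<bar> < e n"
          using Q nk E' c True card unfolding Q_def P_def by auto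
        have drop: "drop (card E') c = c ! card E' # drop (card E) c"
          using True card by (simp add: Cons_nth_drop_Suc)
        have "((\<lambda>m. \<bar>iterated_limit norm (drop (card E) c)
                 (pattern_vector r c E' + sc (c ! card E') (x m)) - iterated_limit norm c 0\<bar>) \<longlongrightarrow>
               \<bar>iterated_limit norm (drop (card E') c) (pattern_vector r c E') - iterated_limit norm c 0\<bar>) U"
          unfolding drop by (intro tendsto_intros iterated_limit_tendsto[where C = 0]) simp
        from order_tendstoD(2)[OF this small] show ?thesis
          by (simp add: P_def E'(2) pattern_vector_update(2)[OF E'(1)])
      next
        case False
        then have Ek: "E \<subseteq> {..<k}" using E by (auto simp: less_Suc_eq)
        then have "P r n E c" using Q nk c by (simp add: Q_def)
        then show ?thesis by (simp add: P_def pattern_vector_update(1)[OF Ek])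
      qed
    qed
    then show "eventually (\<lambda>m. Q (Suc k) (r(k := m))) U"
      unfolding Q_def by (intro eventually_ball_finite ballI finC) auto
  qed (rule that)
  have near: "\<bar>norm (\<Sum>i<k. sc (c ! i) (x (r (n i)))) - iterated_limit norm c 0\<bar> < e N"
    if "strict_mono_on {..<k} n" "\<And>i. i < k \<Longrightarrow> N \<le> n i" "c \<in> C N" "length c = k" for k n N c
  proof -
    have inj: "inj_on n {..<k}" using that(1) strict_mono_on_imp_inj_on by blast
    define E where "E = n ` {..<k}"
    have E: "finite E" "card E = k" using inj by (auto simp: E_def card_image)
    have pos: "card (E \<inter> {..<n i}) = i" if "i < k" for i
    proof -
      have "E \<inter> {..<n i} = n ` {..<i}"
        using \<open>i < k\<close> \<open>strict_mono_on {..<k} n\<close>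
        by (auto simp: E_def strict_mono_on_less[OF \<open>strict_mono_on {..<k} n\<close>])
      then show ?thesis
        using inj \<open>i < k\<close> by (simp add: card_image inj_on_subset[of n "{..<k}"])
    qed
    have pv: "pattern_vector r c E = (\<Sum>i<k. sc (c ! i) (x (r (n i))))"
      unfolding pattern_vector_def unfolding E_def sum.reindex[OF inj]
      using pos by (simp add: E_def)
    obtain K where K: "E \<union> {N} \<subseteq> {..<K}"
      using finite_nat_iff_bounded[of "E \<union> {N}"] E by auto
    then have "P r N E c" using r(2)[of K] \<open>c \<in> C N\<close> by (auto simp: Q_def)
    moreover have "E \<subseteq> {N..}" using that(2) by (auto simp: E_def)
    ultimately show ?thesis using pv E \<open>length c = k\<close> by (simp add: P_def)
  qed
  show thesis
  proof (rule that[OF r(1)])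
    fix k :: nat and \<epsilon> :: real assume \<epsilon>: "0 < \<epsilon>"
    obtain N0 :: nat where N0: "4 / \<epsilon> < real N0" using reals_Archimedean2 by blast
    define N where "N = max N0 k"
    have N: "4 * e N < \<epsilon>" "k \<le> N"
    proof -
      have "4 / \<epsilon> < real N + 1" using N0 by (simp add: N_def)
      then show "4 * e N < \<epsilon>" using \<epsilon> by (simp add: e_def field_simps)
    qed (simp add: N_def)
    have "\<bar>norm (\<Sum>i<k. sc (a i) (x (r (n i)))) - norm (\<Sum>i<k. sc (a i) (x (r (n' i))))\<bar> < \<epsilon>"
      if n: "strict_mono_on {..<k} n" "strict_mono_on {..<k} n'"
        and ge: "\<forall>i<k. N \<le> n i \<and> N \<le> n' i \<and> norm (a i) \<le> 1" for n n' and a :: "nat \<Rightarrow> 'k"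
    proof -
      have "\<forall>i\<in>{..<k}. \<exists>z\<in>Z N. norm (a i - z) < \<theta> N" using Z(2) ge by blast
      then obtain h where h: "\<And>i. i < k \<Longrightarrow> h i \<in> Z N \<and> norm (a i - h i) < \<theta> N"
        by (metis lessThan_iff)
      define c where "c = map h [0..<k]"
      have c: "c \<in> C N" "length c = k" using h N(2) by (auto simp: c_def C_def)
      have approx: "\<bar>norm (\<Sum>i<k. sc (a i) (x (r (n i)))) - norm (\<Sum>i<k. sc (c ! i) (x (r (n i))))\<bar> \<le> e N"
        for n :: "nat \<Rightarrow> nat"
      proof -
        have "norm ((\<Sum>i<k. sc (a i) (x (r (n i)))) - (\<Sum>i<k. sc (c ! i) (x (r (n i)))))
              \<le> real (card {..<k}) * (\<theta> N * B)"
          using h \<theta>[of N] norm_x_le by (intro norm_lincomb_diff_le) (auto simp: c_def less_imp_le)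
        also have "\<dots> \<le> e N" using \<theta>le[OF N(2)] by simp
        finally show ?thesis
          using norm_triangle_ineq3 order_trans by blast
      qed
      have "\<bar>norm (\<Sum>i<k. sc (c ! i) (x (r (n i)))) - iterated_limit norm c 0\<bar> < e N"
           "\<bar>norm (\<Sum>i<k. sc (c ! i) (x (r (n' i)))) - iterated_limit norm c 0\<bar> < e N"
        using near[OF n(1) _ c] near[OF n(2) _ c] ge by auto
      then show ?thesis using approx[of n] approx[of n'] N(1) by linarith
    qed
    then show "\<exists>m::nat. \<forall>n n' (a :: nat \<Rightarrow> 'k). strict_mono_on {..<k} n \<and> strict_mono_on {..<k} n' \<and>
        (\<forall>i<k. m \<le> n i \<and> m \<le> n' i \<and> norm (a i) \<le> 1) \<longrightarrow>
        \<bar>norm (\<Sum>i<k. sc (a i) (x (r (n i)))) - norm (\<Sum>i<k. sc (a i) (x (r (n' i))))\<bar> < \<epsilon>"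
      by blast
  qed
qed

end

section \<open>Projections onto short sets\<close>

context normed_space_over
begin

text \<open>
  The projections are onto \<open>{..<n}\<close> together with at most \<open>q n\<close> further indices, written as one
  set \<open>E\<close> that contains \<open>{..<n}\<close>.
\<close>

definition schreier_projections :: "real \<Rightarrow> (nat \<Rightarrow> nat) \<Rightarrow> (nat \<Rightarrow> 'a) \<Rightarrow> bool" where
  "schreier_projections K q y \<longleftrightarrow>
     (\<forall>n E. \<forall>a\<in>c00. finite E \<and> {..<n} \<subseteq> E \<and> card E \<le> n + q n \<longrightarrow>
        norm (\<Sum>i\<in>E. sc (a i) (y i)) \<le> K * norm (lincomb sc a y))"

lemma schreier_projectionsD:
  "schreier_projections K q y \<Longrightarrow> a \<in> c00 \<Longrightarrow> finite E \<Longrightarrow> {..<n} \<subseteq> E \<Longrightarrow> card E \<le> n + q n \<Longrightarrow>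
    norm (\<Sum>i\<in>E. sc (a i) (y i)) \<le> K * norm (lincomb sc a y)"
  by (auto simp: schreier_projections_def)

lemma schreier_projections_mono:
  "schreier_projections K q y \<Longrightarrow> K \<le> K' \<Longrightarrow> schreier_projections K' q y"
  unfolding schreier_projections_def by (meson mult_right_mono norm_ge_zero order_trans)

lemma schreier_projections_tail:
  assumes K: "schreier_projections K q y" and a: "a \<in> c00"
    and F: "finite F" "F \<subseteq> {n..}" "card F \<le> q n"
  shows "norm (\<Sum>i\<in>F. sc (a i) (y i)) \<le> 2 * K * norm (lincomb sc a y)"
proof -
  have disj: "{..<n} \<inter> F = {}" using F by auto
  have "(\<Sum>i\<in>{..<n} \<union> F. sc (a i) (y i)) = (\<Sum>i<n. sc (a i) (y i)) + (\<Sum>i\<in>F. sc (a i) (y i))"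
    using F disj by (intro sum.union_disjoint) auto
  then have "norm (\<Sum>i\<in>F. sc (a i) (y i))
      \<le> norm (\<Sum>i\<in>{..<n} \<union> F. sc (a i) (y i)) + norm (\<Sum>i<n. sc (a i) (y i))"
    by (metis add_diff_cancel_left' norm_triangle_ineq4)
  moreover have "norm (\<Sum>i\<in>{..<n} \<union> F. sc (a i) (y i)) \<le> K * norm (lincomb sc a y)"
    using F disj by (intro schreier_projectionsD[OF K a, where n = n]) (auto simp: card_Un_disjoint)
  moreover have "norm (\<Sum>i<n. sc (a i) (y i)) \<le> K * norm (lincomb sc a y)"
    by (intro schreier_projectionsD[OF K a, where n = n]) auto
  ultimately show ?thesis by linarith
qed

lemma schreier_projections_coefficient:
  assumes K: "schreier_projections K q y" and a: "a \<in> c00" and q: "1 \<le> q i" and D: "D \<le> norm (y i)"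
  shows "D * norm (a i) \<le> 2 * K * norm (lincomb sc a y)"
proof -
  have "D * norm (a i) \<le> norm (sc (a i) (y i))"
    using mult_right_mono[OF D norm_ge_zero[of "a i"]] by (simp add: norm_scale mult.commute)
  also have "\<dots> \<le> 2 * K * norm (lincomb sc a y)"
    using schreier_projections_tail[OF K a, of "{i}" i] q by simp
  finally show ?thesis .
qed

text \<open>
  With \<open>M = max \<bar>a\<^sub>i\<bar>\<close> attained at \<open>j\<close>, the additive bound at the levels \<open>j\<close> and \<open>j + 1\<close> gives
  \<open>M D \<le> 2\<parallel>v\<parallel> + 2\<eta>M\<close>, and \<open>\<eta> \<le> D / 4\<close> turns this into \<open>M D \<le> 4\<parallel>v\<parallel>\<close>.
  So the additive error \<open>\<eta>M\<close> is at most \<open>\<epsilon>\<parallel>v\<parallel>\<close>.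
\<close>

lemma schreier_projections_subsequence:
  fixes q :: "nat \<Rightarrow> nat"
  assumes wn: "weakly_null sc x" and D: "0 < D" "\<And>n. D \<le> norm (x n)"
    and B: "\<And>n. norm (x n) \<le> B" and \<epsilon>: "0 < \<epsilon>"
  obtains r where "strict_mono r" "schreier_projections (1 + \<epsilon>) q (x \<circ> r)"
proof -
  obtain U where "free_ultrafilter U" using free_ultrafilter_exists by blast
  then interpret ultralimit_sequence sc x U B
    using B by unfold_locales auto
  define \<eta> where "\<eta> = D / 4 * min 1 \<epsilon>"
  have \<eta>: "0 < \<eta>" "\<eta> \<le> D / 4" "4 * \<eta> \<le> \<epsilon> * D"
    using D \<epsilon> by (auto simp: \<eta>_def min_def mult.commute)
  obtain r where r: "strict_mono r" and add:
    "\<forall>n E. \<forall>a\<in>c00. (\<forall>i. norm (a i) \<le> 1) \<and> finite E \<and> {..<n} \<subseteq> E \<and> card E \<le> n + q n \<longrightarrow>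
       norm (\<Sum>i\<in>E. sc (a i) (x (r i))) \<le> norm (lincomb sc a (x \<circ> r)) + \<eta>"
    using additive_projection_bound[OF wn \<eta>(1), of q] by blast
  have "norm (\<Sum>i\<in>E. sc (a i) (x (r i))) \<le> (1 + \<epsilon>) * norm (lincomb sc a (x \<circ> r))"
    if a: "a \<in> c00" and E: "finite E" "{..<n} \<subseteq> E" "card E \<le> n + q n" for n E a
  proof (cases "\<forall>i. a i = 0")
    case True
    then show ?thesis using \<epsilon> by simp
  next
    case False
    define S where "S = {i. a i \<noteq> 0}"
    have S: "finite S" "S \<noteq> {}" using a False by (auto simp: S_def c00_def)
    define M where "M = Max ((\<lambda>i. norm (a i)) ` S)"
    have "M \<in> (\<lambda>i. norm (a i)) ` S" unfolding M_def using S by (intro Max_in) auto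
    then obtain j where j: "j \<in> S" "norm (a j) = M" by auto
    then have M: "0 < M" by (auto simp: S_def)
    have aM: "norm (a i) \<le> M" for i
    proof (cases "i \<in> S")
      case True
      then show ?thesis unfolding M_def using S by (intro Max_ge) auto
    next
      case False
      then show ?thesis using M by (simp add: S_def)
    qed
    define b where "b i = inverse M *\<^sub>R a i" for i
    have b: "b \<in> c00" "norm (b i) \<le> 1" for i
    proof -
      show "b \<in> c00" using a by (auto simp: b_def c00_def)
      have "norm (b i) = inverse M * norm (a i)" using M by (simp add: b_def)
      then show "norm (b i) \<le> 1" using mult_left_mono[OF aM[of i], of "inverse M"] M by simp
    qed
    have bsum: "(\<Sum>i\<in>F. sc (b i) (x (r i))) = inverse M *\<^sub>R (\<Sum>i\<in>F. sc (a i) (x (r i)))" for F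
      by (simp add: b_def scaleR_eq scaleR_sum_right)
    have S': "lincomb sc a (x \<circ> r) = (\<Sum>i\<in>S. sc (a i) (x (r i)))"
        "lincomb sc b (x \<circ> r) = (\<Sum>i\<in>S. sc (b i) (x (r i)))"
      using lincomb_eq_sum[OF S(1), of a "x \<circ> r"] lincomb_eq_sum[OF S(1), of b "x \<circ> r"]
      by (auto simp: S_def b_def)
    have scaled: "norm (\<Sum>i\<in>F. sc (a i) (x (r i))) \<le> norm (lincomb sc a (x \<circ> r)) + \<eta> * M"
      if "finite F" "{..<k} \<subseteq> F" "card F \<le> k + q k" for F k
    proof -
      have "inverse M * norm (\<Sum>i\<in>F. sc (a i) (x (r i)))
            \<le> inverse M * norm (lincomb sc a (x \<circ> r)) + \<eta>"
        using add[rule_format, OF b(1), of F k] b(2) that M unfolding S' bsum by simp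
      then show ?thesis using M by (simp add: field_simps)
    qed
    let ?v = "norm (lincomb sc a (x \<circ> r))"
    have "sc (a j) (x (r j)) = (\<Sum>i<Suc j. sc (a i) (x (r i))) - (\<Sum>i<j. sc (a i) (x (r i)))"
      by simp
    then have "norm (sc (a j) (x (r j)))
        \<le> norm (\<Sum>i<Suc j. sc (a i) (x (r i))) + norm (\<Sum>i<j. sc (a i) (x (r i)))"
      by (metis norm_triangle_ineq4)
    then have "norm (sc (a j) (x (r j))) \<le> 2 * (?v + \<eta> * M)"
      using scaled[of "{..<Suc j}" "Suc j"] scaled[of "{..<j}" j] by simp
    moreover have "M * D \<le> norm (sc (a j) (x (r j)))"
      using j M D(2) by (simp add: norm_scale)
    moreover have "\<eta> * M \<le> D / 4 * M" using \<eta> M by (intro mult_right_mono) auto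
    ultimately have "M * D \<le> 4 * ?v" by (simp add: field_simps)
    then have "\<epsilon> * (M * D) \<le> \<epsilon> * (4 * ?v)" using \<epsilon> by (intro mult_left_mono) auto
    moreover have "4 * \<eta> * M \<le> \<epsilon> * D * M" using \<eta>(3) M by (intro mult_right_mono) auto
    ultimately have "\<eta> * M \<le> \<epsilon> * ?v" by (simp add: field_simps)
    then show ?thesis using scaled[OF E] by (simp add: algebra_simps)
  qed
  then have "schreier_projections (1 + \<epsilon>) q (x \<circ> r)"
    unfolding schreier_projections_def by auto
  then show thesis by (rule that[OF r])
qed

section \<open>Sums of far out terms\<close>

definition nearly_spreading_from :: "nat \<Rightarrow> nat \<Rightarrow> real \<Rightarrow> (nat \<Rightarrow> 'a) \<Rightarrow> bool" where
  "nearly_spreading_from m k \<epsilon> y \<longleftrightarrow>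
     (\<forall>n n' a. strict_mono_on {..<k} n \<and> strict_mono_on {..<k} n' \<and>
        (\<forall>i<k. m \<le> n i \<and> m \<le> n' i \<and> norm (a i) \<le> 1) \<longrightarrow>
        \<bar>norm (\<Sum>i<k. sc (a i) (y (n i))) - norm (\<Sum>i<k. sc (a i) (y (n' i)))\<bar> < \<epsilon>)"

definition spreading :: "(nat \<Rightarrow> 'a) \<Rightarrow> bool" where
  "spreading y \<longleftrightarrow> (\<forall>k. \<forall>\<epsilon>>0. \<exists>m. nearly_spreading_from m k \<epsilon> y)"

lemma nearly_spreading_fromD:
  assumes "nearly_spreading_from m k \<epsilon> y"
    and "strict_mono_on {..<k} n" "strict_mono_on {..<k} n'"
    and "\<And>i. i < k \<Longrightarrow> m \<le> n i" "\<And>i. i < k \<Longrightarrow> m \<le> n' i" "\<And>i. i < k \<Longrightarrow> norm (a i) \<le> 1"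
  shows "\<bar>norm (\<Sum>i<k. sc (a i) (y (n i))) - norm (\<Sum>i<k. sc (a i) (y (n' i)))\<bar> < \<epsilon>"
  using assms unfolding nearly_spreading_from_def by blast

text \<open>
  For a spreading sequence this says that the sums of \<open>k\<close> terms of the spreading model are bounded
  independently of \<open>k\<close>.
\<close>

definition bounded_sums :: "(nat \<Rightarrow> 'a) \<Rightarrow> bool" where
  "bounded_sums y \<longleftrightarrow> (\<exists>K. \<forall>k. \<exists>m. \<forall>F. finite F \<and> F \<subseteq> {m..} \<and> card F = k \<longrightarrow> norm (\<Sum>i\<in>F. y i) \<le> K)"

lemma strict_mono_image_atLeast:
  assumes "strict_mono (r :: nat \<Rightarrow> nat)" "F \<subseteq> {m..}"
  shows "r ` F \<subseteq> {m..}"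
proof
  fix j assume "j \<in> r ` F"
  then obtain i where "i \<in> F" "j = r i" by blast
  then show "j \<in> {m..}" using strict_mono_imp_increasing[OF assms(1), of i] assms(2) by auto
qed

lemma spreading_subseq:
  assumes "spreading y" "strict_mono r"
  shows "spreading (y \<circ> r)"
proof -
  have "nearly_spreading_from m k \<epsilon> (y \<circ> r)" if "nearly_spreading_from m k \<epsilon> y" for m k \<epsilon>
    unfolding nearly_spreading_from_def
  proof (intro allI impI, elim conjE)
    fix n n' and a :: "nat \<Rightarrow> 'k"
    assume n: "strict_mono_on {..<k} n" "strict_mono_on {..<k} n'"
      and ge: "\<forall>i<k. m \<le> n i \<and> m \<le> n' i \<and> norm (a i) \<le> 1"
    have sm: "strict_mono_on {..<k} (r \<circ> n)" if "strict_mono_on {..<k} n" for n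
      using that assms(2) by (auto simp: strict_mono_on_def strict_mono_def)
    have le: "m \<le> r j" if "m \<le> j" for j
      using that strict_mono_imp_increasing[OF assms(2), of j] by simp
    show "\<bar>norm (\<Sum>i<k. sc (a i) ((y \<circ> r) (n i))) - norm (\<Sum>i<k. sc (a i) ((y \<circ> r) (n' i)))\<bar> < \<epsilon>"
      using nearly_spreading_fromD[OF that sm[OF n(1)] sm[OF n(2)], of a] le ge by simp
  qed
  then show ?thesis using assms(1) unfolding spreading_def by blast
qed

lemma bounded_sums_subseq:
  assumes "bounded_sums y" "strict_mono r"
  shows "bounded_sums (y \<circ> r)"
proof -
  obtain K where K: "\<And>k. \<exists>m. \<forall>F. finite F \<and> F \<subseteq> {m..} \<and> card F = k \<longrightarrow> norm (\<Sum>i\<in>F. y i) \<le> K"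
    using assms(1) unfolding bounded_sums_def by blast
  have "\<exists>m. \<forall>F. finite F \<and> F \<subseteq> {m..} \<and> card F = k \<longrightarrow> norm (\<Sum>i\<in>F. (y \<circ> r) i) \<le> K" for k
  proof -
    obtain m where m: "\<And>F. finite F \<Longrightarrow> F \<subseteq> {m..} \<Longrightarrow> card F = k \<Longrightarrow> norm (\<Sum>i\<in>F. y i) \<le> K"
      using K[of k] by blast
    have "norm (\<Sum>i\<in>F. (y \<circ> r) i) \<le> K" if F: "finite F" "F \<subseteq> {m..}" "card F = k" for F
    proof -
      have inj: "inj_on r F" using assms(2) strict_mono_imp_inj_on inj_on_subset by blast
      have "r ` F \<subseteq> {m..}" using strict_mono_image_atLeast[OF assms(2) F(2)] .
      then show ?thesis
        using m[of "r ` F"] F inj by (simp add: card_image sum.reindex)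
    qed
    then show ?thesis by blast
  qed
  then show ?thesis unfolding bounded_sums_def by blast
qed

text \<open>
  One large sum of \<open>k\<close> far out terms forces all of them to be large.
\<close>

lemma unbounded_sums_spreading:
  assumes sp: "spreading y" and unb: "\<not> bounded_sums y"
  shows "\<exists>k m. \<forall>F. finite F \<and> F \<subseteq> {m..} \<and> card F = k \<longrightarrow> K < norm (\<Sum>i\<in>F. y i)"
proof -
  have "\<not> (\<forall>k. \<exists>m. \<forall>F. finite F \<and> F \<subseteq> {m..} \<and> card F = k \<longrightarrow> norm (\<Sum>i\<in>F. y i) \<le> K + 1)"
    using unb unfolding bounded_sums_def by (rule contrapos_nn) (rule exI)
  then obtain k where k: "\<And>m. \<exists>F. (finite F \<and> F \<subseteq> {m..} \<and> card F = k) \<and> K + 1 < norm (\<Sum>i\<in>F. y i)"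
    by (simp only: not_all not_ex not_imp not_le) blast
  obtain m where m: "nearly_spreading_from m k 1 y"
    using sp zero_less_one unfolding spreading_def by blast
  have enum: "\<exists>n. strict_mono_on {..<k} n \<and> (\<forall>i<k. m \<le> n i) \<and> (\<Sum>i<k. y (n i)) = (\<Sum>i\<in>F. y i)"
    if "finite F" "F \<subseteq> {m..}" "card F = k" for F
  proof -
    obtain n where n: "bij_betw n {..<k} F" "strict_mono_on {..<k} n"
      using ex_bij_betw_strict_mono_card[OF \<open>finite F\<close>] \<open>card F = k\<close> by metis
    moreover have "m \<le> n i" if "i < k" for i
      using n(1) \<open>F \<subseteq> {m..}\<close> that by (auto dest: bij_betwE)
    ultimately show ?thesis using sum.reindex_bij_betw[OF n(1), of y] by auto
  qed
  obtain F0 where F0: "finite F0" "F0 \<subseteq> {m..}" "card F0 = k" "K + 1 < norm (\<Sum>i\<in>F0. y i)"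
    using k by blast
  then obtain n0 where n0: "strict_mono_on {..<k} n0" "\<forall>i<k. m \<le> n0 i"
      "(\<Sum>i<k. y (n0 i)) = (\<Sum>i\<in>F0. y i)"
    using enum by metis
  show ?thesis
  proof (intro exI allI impI)
    fix F assume "finite F \<and> F \<subseteq> {m..} \<and> card F = k"
    then obtain n where n: "strict_mono_on {..<k} n" "\<forall>i<k. m \<le> n i" "(\<Sum>i<k. y (n i)) = (\<Sum>i\<in>F. y i)"
      using enum by metis
    show "K < norm (\<Sum>i\<in>F. y i)"
      using nearly_spreading_fromD[OF m n(1) n0(1), of "\<lambda>_. 1"] n n0 F0(4) by simp
  qed
qed

text \<open>
  Among many coefficients of absolute value at least \<open>\<delta>\<close>, at least \<open>p\<close> are close to a single
  scalar \<open>z\<close> with \<open>\<bar>z\<bar> \<ge> \<delta> / 2\<close>. The projection onto \<open>p\<close> such indices has norm at most \<open>4 C\<close>,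
  but it is nearly \<open>z\<close> times a sum of \<open>p\<close> far out terms, whose norm exceeds any given bound for a
  suitable \<open>p\<close>. The bound \<open>N\<close> serves all further subsequences \<open>y \<circ> r\<close> and all \<open>q\<close>,
  because \<open>q\<close> will be chosen depending on it. The first \<open>n0\<close> indices are given up: beyond them
  the sums are large and \<open>p\<close> indices are few enough for the projection.
\<close>

lemma few_large_coefficients:
  assumes sp: "spreading y" and unb: "\<not> bounded_sums y" and B: "\<And>n. norm (y n) \<le> B" and \<delta>: "0 < \<delta>"
  obtains N where "\<And>r q a. strict_mono r \<Longrightarrow> schreier_projections 2 q (y \<circ> r) \<Longrightarrow> (\<And>n. n \<le> q n) \<Longrightarrow>
      a \<in> c00 \<Longrightarrow> (\<And>i. norm (a i) \<le> 1) \<Longrightarrow> norm (lincomb sc a (y \<circ> r)) \<le> C \<Longrightarrow>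
      card {i. \<delta> \<le> norm (a i)} \<le> N"
proof -
  have B0: "0 \<le> B" using B[of 0] norm_ge_zero order_trans by blast
  obtain p m where pm: "\<forall>F. finite F \<and> F \<subseteq> {m..} \<and> card F = p \<longrightarrow>
      (4 * C + 1) * 2 / \<delta> < norm (\<Sum>i\<in>F. y i)"
    using unbounded_sums_spreading[OF sp unb] by blast
  \<comment> \<open>Fine enough to keep \<open>\<bar>z\<bar>\<close> away from 0 and to change a sum of \<open>p\<close> terms by at most 1.\<close>
  define \<theta> where "\<theta> = min (\<delta> / 2) (1 / (real p * B + 1))"
  have pB: "0 < real p * B + 1" using B0 by (simp add: add_nonneg_pos)
  then have \<theta>: "0 < \<theta>" "\<theta> \<le> \<delta> / 2" "\<theta> \<le> 1 / (real p * B + 1)"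
    using \<delta> by (auto simp: \<theta>_def)
  have "\<theta> * (real p * B) \<le> 1 / (real p * B + 1) * (real p * B)"
    using \<theta>(3) B0 by (intro mult_right_mono) auto
  also have "\<dots> \<le> 1" using pB by (simp add: divide_le_eq)
  finally have \<theta>p: "real p * (\<theta> * B) \<le> 1" by (simp add: ac_simps)
  obtain Z :: "'k set" where Z: "finite Z" "\<And>t. norm t \<le> 1 \<Longrightarrow> \<exists>z\<in>Z. norm (t - z) < \<theta>"
    using unit_ball_finite_net[OF \<theta>(1)] by metis
  define n0 where "n0 = max m p"
  show thesis
  proof (rule that[of "n0 + card Z * p"], rule ccontr)
    fix r q and a :: "nat \<Rightarrow> 'k"
    assume r: "strict_mono r" and sch: "schreier_projections 2 q (y \<circ> r)" and q: "\<And>n. n \<le> q n"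
      and a: "a \<in> c00" "\<And>i. norm (a i) \<le> 1" and C: "norm (lincomb sc a (y \<circ> r)) \<le> C"
      and many: "\<not> card {i. \<delta> \<le> norm (a i)} \<le> n0 + card Z * p"
    define L where "L = {i. \<delta> \<le> norm (a i)}"
    have L: "finite L"
    proof (rule finite_subset)
      show "L \<subseteq> {i. a i \<noteq> 0}" using \<delta> by (auto simp: L_def)
      show "finite {i. a i \<noteq> 0}" using a(1) by (simp add: c00_def)
    qed
    have "card L \<le> card {..<n0} + card (L - {..<n0})"
      using L card_Un_le[of "{..<n0}" "L - {..<n0}"] card_mono[of "{..<n0} \<union> (L - {..<n0})" L] by auto
    then have big: "card Z * p < card (L - {..<n0})" using many by (simp add: L_def)
    define fib where "fib z = {i \<in> L - {..<n0}. norm (a i - z) < \<theta>}" for z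
    have "\<exists>z\<in>Z. p \<le> card (fib z)"
    proof (rule ccontr)
      assume "\<not> (\<exists>z\<in>Z. p \<le> card (fib z))"
      then have "card (fib z) \<le> p" if "z \<in> Z" for z using that by (meson less_imp_le not_le)
      then have "(\<Sum>z\<in>Z. card (fib z)) \<le> card Z * p"
        using sum_bounded_above[of Z "\<lambda>z. card (fib z)" p] by simp
      moreover have "L - {..<n0} \<subseteq> (\<Union>z\<in>Z. fib z)"
        using Z(2)[OF a(2)] by (fastforce simp: fib_def)
      then have "card (L - {..<n0}) \<le> card (\<Union>z\<in>Z. fib z)"
        using Z(1) L by (intro card_mono) (auto simp: fib_def)
      moreover have "card (\<Union>z\<in>Z. fib z) \<le> (\<Sum>z\<in>Z. card (fib z))"
        by (rule card_UN_le[OF Z(1)])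
      ultimately show False using big by linarith
    qed
    then obtain z where z: "z \<in> Z" "p \<le> card (fib z)" by blast
    then obtain F where F: "F \<subseteq> fib z" "card F = p" "finite F"
      using obtain_subset_with_card_n[of p "fib z"] by metis
    have Fn0: "F \<subseteq> {n0..}" using F(1) by (auto simp: fib_def)
    have inj: "inj_on r F" using r strict_mono_imp_inj_on inj_on_subset by blast
    have "F \<subseteq> {m..}" using Fn0 by (auto simp: n0_def)
    then have "r ` F \<subseteq> {m..}" by (rule strict_mono_image_atLeast[OF r])
    then have lower: "(4 * C + 1) * 2 / \<delta> < norm (\<Sum>i\<in>F. y (r i))"
      using pm[rule_format, of "r ` F"] F inj by (simp add: card_image sum.reindex)
    have p0: "F \<noteq> {}"
    proof
      assume "F = {}"
      then have "(4 * C + 1) * 2 / \<delta> < 0" using lower by simp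
      moreover have "0 \<le> C" using C norm_ge_zero order_trans by blast
      ultimately show False using \<delta> by (simp add: divide_less_0_iff)
    qed
    have zF: "norm (a i - z) < \<theta>" "\<delta> \<le> norm (a i)" if "i \<in> F" for i
      using F(1) that by (auto simp: fib_def L_def)
    obtain i0 where "i0 \<in> F" using p0 by blast
    then have "\<delta> / 2 \<le> norm z"
      using zF[of i0] \<theta>(2) norm_triangle_sub[of "a i0" z] by linarith
    then have "\<delta> / 2 * norm (\<Sum>i\<in>F. y (r i)) \<le> norm z * norm (\<Sum>i\<in>F. y (r i))"
      by (intro mult_right_mono) auto
    also have "\<dots> = norm (\<Sum>i\<in>F. sc z (y (r i)))"
      by (simp add: norm_scale flip: scale_sum_right)
    also have "\<dots> \<le> norm (\<Sum>i\<in>F. sc (a i) (y (r i)))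
        + norm ((\<Sum>i\<in>F. sc z (y (r i))) - (\<Sum>i\<in>F. sc (a i) (y (r i))))"
      by (rule norm_triangle_sub)
    also have "norm ((\<Sum>i\<in>F. sc z (y (r i))) - (\<Sum>i\<in>F. sc (a i) (y (r i)))) \<le> real (card F) * (\<theta> * B)"
      using zF B \<theta> by (intro norm_lincomb_diff_le) (auto simp: norm_minus_commute less_imp_le)
    also have "\<dots> \<le> 1" using \<theta>p F by simp
    also have "norm (\<Sum>i\<in>F. sc (a i) (y (r i))) \<le> 2 * 2 * norm (lincomb sc a (y \<circ> r))"
    proof -
      have "card F \<le> q n0" using q[of n0] F by (simp add: n0_def)
      from schreier_projections_tail[OF sch a(1) F(3) Fn0 this] show ?thesis by simp
    qed
    finally have "\<delta> / 2 * norm (\<Sum>i\<in>F. y (r i)) \<le> 4 * C + 1" using C by simp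
    then show False using lower \<delta> by (simp add: field_simps)
  qed
qed

end

section \<open>Bounded sums produce a c0 spreading model\<close>

text \<open>
  A convex function on a cube attains its maximum at a vertex.
\<close>

lemma norm_box_le_vertex:
  fixes y :: "'i \<Rightarrow> 'a::real_normed_vector"
  assumes "finite F" "\<And>i. i \<in> F \<Longrightarrow> 0 \<le> t i \<and> t i \<le> 1"
  shows "\<exists>G\<subseteq>F. norm (u + (\<Sum>i\<in>F. t i *\<^sub>R y i)) \<le> norm (u + (\<Sum>i\<in>G. y i))"
  using assms
proof (induction F arbitrary: u rule: finite_induct)
  case empty
  then show ?case by simp
next
  case (insert k F)
  then obtain G where G: "G \<subseteq> F" and
    le: "norm ((u + t k *\<^sub>R y k) + (\<Sum>i\<in>F. t i *\<^sub>R y i)) \<le> norm ((u + t k *\<^sub>R y k) + (\<Sum>i\<in>G. y i))"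
    by (metis insertCI)
  let ?v = "u + (\<Sum>i\<in>G. y i)"
  have t: "0 \<le> t k" "t k \<le> 1" using insert by auto
  have "(u + t k *\<^sub>R y k) + (\<Sum>i\<in>G. y i) = (1 - t k) *\<^sub>R ?v + t k *\<^sub>R (?v + y k)"
    by (simp add: algebra_simps)
  also have "norm \<dots> \<le> (1 - t k) * norm ?v + t k * norm (?v + y k)"
    by (rule norm_triangle_le) (use t in simp)
  also have "\<dots> \<le> max (norm ?v) (norm (?v + y k))"
    using t by (intro convex_bound_le) auto
  finally have "norm ((u + t k *\<^sub>R y k) + (\<Sum>i\<in>F. t i *\<^sub>R y i)) \<le> max (norm ?v) (norm (?v + y k))"
    using le by simp
  moreover have "u + (\<Sum>i\<in>insert k F. t i *\<^sub>R y i) = (u + t k *\<^sub>R y k) + (\<Sum>i\<in>F. t i *\<^sub>R y i)"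
    using insert by (simp add: add.assoc)
  moreover have "?v + y k = u + (\<Sum>i\<in>insert k G. y i)"
  proof -
    have "finite G" "k \<notin> G" using G insert finite_subset by auto
    then show ?thesis by (simp add: algebra_simps)
  qed
  ultimately have "norm (u + (\<Sum>i\<in>insert k F. t i *\<^sub>R y i)) \<le> norm ?v \<or>
      norm (u + (\<Sum>i\<in>insert k F. t i *\<^sub>R y i)) \<le> norm (u + (\<Sum>i\<in>insert k G. y i))"
    by (simp add: le_max_iff_disj add.assoc)
  then show ?case
  proof
    assume "norm (u + (\<Sum>i\<in>insert k F. t i *\<^sub>R y i)) \<le> norm ?v"
    then show ?case using G by (intro exI[of _ G]) auto
  next
    assume "norm (u + (\<Sum>i\<in>insert k F. t i *\<^sub>R y i)) \<le> norm (u + (\<Sum>i\<in>insert k G. y i))"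
    then show ?case using G by (intro exI[of _ "insert k G"]) auto
  qed
qed

lemma norm_real_combination_le:
  fixes y :: "'i \<Rightarrow> 'a::real_normed_vector"
  assumes F: "finite F" and t: "\<And>i. i \<in> F \<Longrightarrow> \<bar>t i\<bar> \<le> 1"
    and K: "\<And>G. G \<subseteq> F \<Longrightarrow> norm (\<Sum>i\<in>G. y i) \<le> K"
  shows "norm (\<Sum>i\<in>F. t i *\<^sub>R y i) \<le> 2 * K"
proof -
  have part: "norm (\<Sum>i\<in>F. s i *\<^sub>R y i) \<le> K" if "\<And>i. i \<in> F \<Longrightarrow> 0 \<le> s i \<and> s i \<le> 1" for s
  proof -
    have "\<exists>G\<subseteq>F. norm (0 + (\<Sum>i\<in>F. s i *\<^sub>R y i)) \<le> norm (0 + (\<Sum>i\<in>G. y i))"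
      by (rule norm_box_le_vertex[OF F that])
    then obtain G where "G \<subseteq> F" "norm (\<Sum>i\<in>F. s i *\<^sub>R y i) \<le> norm (\<Sum>i\<in>G. y i)" by auto
    then show ?thesis using K[of G] by linarith
  qed
  have "(\<Sum>i\<in>F. t i *\<^sub>R y i) = (\<Sum>i\<in>F. max (t i) 0 *\<^sub>R y i) - (\<Sum>i\<in>F. max (- t i) 0 *\<^sub>R y i)"
    unfolding sum_subtractf[symmetric] scaleR_left_diff_distrib[symmetric]
    by (intro sum.cong) (auto simp: max_def)
  also have "norm \<dots> \<le> norm (\<Sum>i\<in>F. max (t i) 0 *\<^sub>R y i) + norm (\<Sum>i\<in>F. max (- t i) 0 *\<^sub>R y i)"
    by (rule norm_triangle_ineq4)
  also have "\<dots> \<le> K + K"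
  proof (intro add_mono part)
    show "0 \<le> max (t i) 0 \<and> max (t i) 0 \<le> 1" if "i \<in> F" for i using t[OF that] by auto
    show "0 \<le> max (- t i) 0 \<and> max (- t i) 0 \<le> 1" if "i \<in> F" for i using t[OF that] by auto
  qed
  finally show ?thesis by simp
qed

context normed_space_over
begin

lemma norm_scalar_combination_le:
  assumes F: "finite F" and a: "\<And>i. i \<in> F \<Longrightarrow> norm (a i) \<le> 1"
    and K: "\<And>G. G \<subseteq> F \<Longrightarrow> norm (\<Sum>i\<in>G. y i) \<le> K"
  shows "norm (\<Sum>i\<in>F. sc (a i) (y i)) \<le> real DIM('k) * (2 * K)"
proof -
  have "(\<Sum>i\<in>F. sc (a i) (y i)) = (\<Sum>i\<in>F. \<Sum>b\<in>Basis. (a i \<bullet> b) *\<^sub>R sc b (y i))"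
    by (intro sum.cong refl scale_Basis_expansion)
  also have "\<dots> = (\<Sum>b\<in>Basis. sc b (\<Sum>i\<in>F. (a i \<bullet> b) *\<^sub>R y i))"
    by (subst sum.swap) (simp add: scale_sum_right scale_scaleR)
  also have "norm \<dots> \<le> (\<Sum>b\<in>(Basis::'k set). 2 * K)"
  proof (rule sum_norm_le)
    fix b :: 'k assume b: "b \<in> Basis"
    have "norm (\<Sum>i\<in>F. (a i \<bullet> b) *\<^sub>R y i) \<le> 2 * K"
    proof (rule norm_real_combination_le[OF F _ K])
      show "\<bar>a i \<bullet> b\<bar> \<le> 1" if "i \<in> F" for i
        using Basis_le_norm[OF b, of "a i"] a[OF that] by linarith
    qed
    then show "norm (sc b (\<Sum>i\<in>F. (a i \<bullet> b) *\<^sub>R y i)) \<le> 2 * K" using b by (simp add: norm_scale)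
  qed
  finally show ?thesis by simp
qed

end

text \<open>
  A seminorm on the null sequences that is equivalent to the supremum norm is a complete norm: a Cauchy
  sequence converges uniformly, and uniform limits of null sequences are null sequences.
\<close>

lemma banach_space_on_null_sequences:
  fixes N :: "(nat \<Rightarrow> 'k::{real_normed_field, euclidean_space}) \<Rightarrow> real"
  defines "V \<equiv> {b. b \<longlonglongrightarrow> 0}"
  assumes scale: "\<And>c b. b \<in> V \<Longrightarrow> N (seq_scale c b) = norm c * N b"
    and triangle: "\<And>b b'. b \<in> V \<Longrightarrow> b' \<in> V \<Longrightarrow> N (b + b') \<le> N b + N b'"
    and c: "0 < c" and lower: "\<And>b i. b \<in> V \<Longrightarrow> c * norm (b i) \<le> N b"
    and upper: "\<And>b A. b \<in> V \<Longrightarrow> (\<And>i. norm (b i) \<le> A) \<Longrightarrow> N b \<le> C * A"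
  shows "banach_space_on seq_scale V N"
proof -
  have scV: "seq_scale k b \<in> V" if "b \<in> V" for k b
    using that tendsto_mult_right_zero[of b sequentially k] by (auto simp: V_def seq_scale_def)
  have addV: "b + b' \<in> V" if "b \<in> V" "b' \<in> V" for b b'
    using that tendsto_add[of b 0 sequentially b' 0] by (auto simp: V_def plus_fun_def)
  have diffV: "b - b' \<in> V" if "b \<in> V" "b' \<in> V" for b b'
    using that tendsto_diff[of b 0 sequentially b' 0] by (auto simp: V_def fun_diff_def)
  have zeroV: "0 \<in> V" by (simp add: V_def zero_fun_def)
  have nonneg: "0 \<le> N b" if "b \<in> V" for b
  proof -
    have "0 \<le> c * norm (b 0)" using c by simp
    then show ?thesis using lower[OF that, of 0] by linarith
  qed
  interpret S: vector_space "seq_scale :: 'k \<Rightarrow> _" by (rule vector_space_seq_scale)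
  show ?thesis
  proof unfold_locales
    show "S.subspace V" by (simp add: S.subspace_def zeroV addV scV)
  next
    fix v assume v: "v \<in> V"
    show "N v = 0 \<longleftrightarrow> v = 0"
    proof
      assume "N v = 0"
      then have "c * norm (v i) \<le> 0" for i using lower[OF v, of i] by simp
      then have "v i = 0" for i using c by (simp add: mult_le_0_iff)
      then show "v = 0" by (simp add: fun_eq_iff)
    next
      assume "v = 0"
      then show "N v = 0" using upper[OF v, of 0] nonneg[OF v] by simp
    qed
  next
    fix u :: "nat \<Rightarrow> nat \<Rightarrow> 'k"
    assume "range u \<subseteq> V"
      and Cauchy: "\<And>e. 0 < e \<Longrightarrow> \<exists>M. \<forall>m\<ge>M. \<forall>n\<ge>M. N (u m - u n) < e"
    then have uV: "u n \<in> V" for n by auto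
    have "uniformly_Cauchy_on UNIV u"
    proof (rule uniformly_Cauchy_onI)
      fix e :: real assume "0 < e"
      then obtain M where M: "\<forall>m\<ge>M. \<forall>n\<ge>M. N (u m - u n) < c * e"
        using Cauchy[of "c * e"] c by auto
      have "dist (u m j) (u n j) < e" if "m \<ge> M" "n \<ge> M" for m n j
      proof -
        have "c * norm ((u m - u n) j) < c * e"
          using lower[OF diffV[OF uV uV], of m n j] M that by fastforce
        then show ?thesis using c by (simp add: dist_norm)
      qed
      then show "\<exists>M. \<forall>j\<in>UNIV. \<forall>m\<ge>M. \<forall>n\<ge>M. dist (u m j) (u n j) < e" by blast
    qed
    then have "uniformly_convergent_on UNIV u" by (rule Cauchy_uniformly_convergent)
    then obtain v where v: "uniform_limit UNIV u v sequentially"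
      unfolding uniformly_convergent_on_def by blast
    have "v \<in> V"
      unfolding V_def mem_Collect_eq
    proof (rule swap_uniform_limit'[OF _ _ v])
      show "eventually (\<lambda>n. u n \<longlonglongrightarrow> 0) sequentially" using uV by (simp add: V_def)
    qed auto
    moreover have "(\<lambda>n. N (u n - v)) \<longlonglongrightarrow> 0"
    proof (rule LIMSEQ_I)
      fix e :: real assume e: "0 < e"
      define d where "d = e / (2 * max C 1)"
      have d: "0 < d" "max C 1 * d < e" using e by (auto simp: d_def field_simps)
      have "C * d \<le> max C 1 * d" using d by (intro mult_right_mono) auto
      then have "C * d < e" using d by linarith
      obtain M where M: "\<forall>n\<ge>M. \<forall>j\<in>UNIV. dist (u n j) (v j) < d"
        using uniform_limitD[OF v d(1)] unfolding eventually_sequentially by blast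
      have "norm (N (u n - v) - 0) < e" if "n \<ge> M" for n
      proof -
        have "u n - v \<in> V" using diffV[OF uV \<open>v \<in> V\<close>] .
        moreover have "norm ((u n - v) j) \<le> d" for j
          using M that by (simp add: dist_norm less_imp_le)
        ultimately have "N (u n - v) \<le> C * d" "0 \<le> N (u n - v)" using upper nonneg by auto
        then show ?thesis using \<open>C * d < e\<close> by simp
      qed
      then show "\<exists>M. \<forall>n\<ge>M. norm (N (u n - v) - 0) < e" by blast
    qed
    ultimately show "\<exists>v\<in>V. (\<lambda>n. N (u n - v)) \<longlonglongrightarrow> 0" by blast
  qed (use scale triangle nonneg in auto)
qed

context normed_space_over
begin

text \<open>
  One threshold \<open>M k\<close> for all sums of at most \<open>k\<close> terms, also at least \<open>k\<close>, so that it tends to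
  infinity.
\<close>

lemma bounded_sums_uniform:
  assumes "bounded_sums y"
  obtains K M where "\<And>k. k \<le> M k"
    "\<And>k F. finite F \<Longrightarrow> F \<subseteq> {M k..} \<Longrightarrow> card F \<le> k \<Longrightarrow> norm (\<Sum>i\<in>F. y i) \<le> K"
proof -
  obtain K where "\<forall>k. \<exists>m. \<forall>F. finite F \<and> F \<subseteq> {m..} \<and> card F = k \<longrightarrow> norm (\<Sum>i\<in>F. y i) \<le> K"
    using assms unfolding bounded_sums_def by blast
  from choice[OF this] obtain m where
    m: "\<forall>k F. finite F \<and> F \<subseteq> {m k..} \<and> card F = k \<longrightarrow> norm (\<Sum>i\<in>F. y i) \<le> K" by blast
  define M where "M k = k + (\<Sum>j\<le>k. m j)" for k
  have "m j \<le> M k" if "j \<le> k" for j k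
    using member_le_sum[of j "{..k}" m] that by (simp add: M_def)
  then have "norm (\<Sum>i\<in>F. y i) \<le> K" if "finite F" "F \<subseteq> {M k..}" "card F \<le> k" for k F
    using m[rule_format, of F "card F"] that by (meson atLeast_subset_iff order_trans)
  then show thesis by (intro that[of M K]) (simp_all add: M_def)
qed

text \<open>
  The norm of a null sequence \<open>b\<close> is the limit along an ultrafilter of the norms of combinations of
  \<open>k\<close> consecutive vectors with the coefficients \<open>b 0, \<dots>, b (k - 1)\<close>, shifted so far out that
  the bound on sums applies. It inherits homogeneity and the triangle inequality, and the two-sided
  estimate by the supremum norm, from the given norm. For a finitely supported \<open>b\<close> the shift does not
  matter in the limit, because \<open>y\<close> is spreading; so the unit vectors are the spreading model.
\<close>

lemma has_c0_spreading_model_of_bounded_sums: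
  assumes sp: "spreading y" and bounded: "bounded_sums y" and c: "0 < c"
    and lower: "\<And>a i. a \<in> c00 \<Longrightarrow> c * norm (a i) \<le> norm (lincomb sc a y)"
  shows "has_c0_spreading_model sc y"
proof -
  obtain U where U: "free_ultrafilter U" using free_ultrafilter_exists by blast
  then have U_nb: "U \<noteq> bot" and U_free: "U \<le> sequentially" by (auto simp: free_ultrafilter_def)
  obtain K M where kM: "\<And>k. k \<le> M k" and
    K: "\<And>k F. finite F \<Longrightarrow> F \<subseteq> {M k..} \<Longrightarrow> card F \<le> k \<Longrightarrow> norm (\<Sum>i\<in>F. y i) \<le> K"
    using bounded_sums_uniform[OF bounded] by metis
  define C where "C = real DIM('k) * (2 * K)"
  define g where "g b k = norm (\<Sum>i<k. sc (b i) (y (M k + i)))" for b k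
  define N where "N b = Lim U (g b)" for b
  define V where "V = {b :: nat \<Rightarrow> 'k. b \<longlonglongrightarrow> 0}"
  define s :: "nat \<Rightarrow> nat \<Rightarrow> 'k" where "s = (\<lambda>i j. if j = i then 1 else 0)"
  have sum_y: "norm (\<Sum>i\<in>G. y (M k + i)) \<le> K" if "G \<subseteq> {..<k}" for G k
  proof -
    have "inj_on ((+) (M k)) G" by simp
    then have "(\<Sum>i\<in>G. y (M k + i)) = (\<Sum>i\<in>(+) (M k) ` G. y i)" by (simp add: sum.reindex)
    moreover have "finite G" "card G \<le> k" using that finite_subset card_mono[OF _ that] by auto
    moreover have "(+) (M k) ` G \<subseteq> {M k..}" by auto
    ultimately show ?thesis
      using K[of "(+) (M k) ` G" k] card_image_le[of G "(+) (M k)"] by simp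
  qed
  have g_upper: "g b k \<le> C * A" if A: "\<And>i. norm (b i) \<le> A" for b A k
  proof (cases "A = 0")
    case True
    then show ?thesis using A by (simp add: g_def)
  next
    case False
    then have A0: "0 < A" using A[of 0] norm_ge_zero[of "b 0"] by linarith
    define b' where "b' i = inverse A *\<^sub>R b i" for i
    have "norm (b' i) = inverse A * norm (b i)" for i
      using A0 by (simp add: b'_def)
    then have "norm (b' i) \<le> 1" for i
      using mult_left_mono[OF A[of i], of "inverse A"] A0 by simp
    then have "norm (\<Sum>i<k. sc (b' i) (y (M k + i))) \<le> C"
      unfolding C_def using sum_y by (intro norm_scalar_combination_le) auto
    moreover have "(\<Sum>i<k. sc (b' i) (y (M k + i))) = inverse A *\<^sub>R (\<Sum>i<k. sc (b i) (y (M k + i)))"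
      by (simp add: b'_def scaleR_eq scaleR_sum_right)
    ultimately have "inverse A * g b k \<le> C" using A0 by (simp add: g_def)
    then show ?thesis using A0 by (simp add: field_simps)
  qed
  have g_lower: "c * norm (b i) \<le> g b k" if "i < k" for b i k
  proof -
    define a where "a j = (if j \<in> {M k..<M k + k} then b (j - M k) else 0)" for j
    have "{j. a j \<noteq> 0} \<subseteq> {M k..<M k + k}" by (auto simp: a_def)
    then have "a \<in> c00" unfolding c00_def using finite_subset by blast
    moreover have "lincomb sc a y = (\<Sum>j\<in>{M k..<M k + k}. sc (a j) (y j))"
      by (rule lincomb_eq_sum) (auto simp: a_def split: if_splits)
    then have "lincomb sc a y = (\<Sum>i<k. sc (b i) (y (M k + i)))"
      using sum.shift_bounds_nat_ivl[of "\<lambda>j. sc (a j) (y j)" 0 "M k" k]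
      by (simp add: a_def add.commute atLeast0LessThan)
    ultimately show ?thesis
      using lower[of a "M k + i"] that by (simp add: g_def a_def)
  qed
  have bounded_V: "\<exists>A. \<forall>i. norm (b i) \<le> A" if "b \<in> V" for b
    using convergent_imp_Bseq[of b] that by (auto simp: V_def convergent_def Bseq_def)
  have lim: "(g b \<longlongrightarrow> N b) U" if "b \<in> V" for b
  proof -
    obtain A where "\<And>i. norm (b i) \<le> A" using bounded_V[OF \<open>b \<in> V\<close>] by blast
    then have "\<bar>g b k\<bar> \<le> C * A" for k using g_upper[of b A k] by (simp add: g_def)
    then show ?thesis unfolding N_def by (rule free_ultrafilter_bounded_convergent[OF U])
  qed
  have N_lower: "c * norm (b i) \<le> N b" if "b \<in> V" for b i
  proof (rule tendsto_lowerbound[OF lim[OF that] _ U_nb])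
    have "eventually (\<lambda>k. i < k) U" using eventually_gt_at_top U_free by (rule filter_leD[rotated])
    then show "eventually (\<lambda>k. c * norm (b i) \<le> g b k) U"
      by eventually_elim (rule g_lower)
  qed
  have N_upper: "N b \<le> C * A" if "b \<in> V" "\<And>i. norm (b i) \<le> A" for b A
    by (rule tendsto_upperbound[OF lim[OF that(1)] _ U_nb]) (simp add: g_upper[OF that(2)])
  have ban: "banach_space_on seq_scale V N"
    unfolding V_def
  proof (rule banach_space_on_null_sequences[where c = c and C = C], fold V_def)
    fix k and b :: "nat \<Rightarrow> 'k" assume b: "b \<in> V"
    have "seq_scale k b \<in> V"
      using b tendsto_mult_right_zero[of b sequentially k] by (auto simp: V_def seq_scale_def)
    moreover have "g (seq_scale k b) = (\<lambda>j. norm k * g b j)"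
      by (simp add: g_def seq_scale_def fun_eq_iff norm_scale[symmetric] scale_sum_right)
    ultimately have "((\<lambda>j. norm k * g b j) \<longlongrightarrow> N (seq_scale k b)) U"
      using lim[of "seq_scale k b"] by simp
    moreover have "((\<lambda>j. norm k * g b j) \<longlongrightarrow> norm k * N b) U"
      by (intro tendsto_intros lim b)
    ultimately show "N (seq_scale k b) = norm k * N b" by (rule tendsto_unique[OF U_nb])
  next
    fix b b' :: "nat \<Rightarrow> 'k" assume b: "b \<in> V" "b' \<in> V"
    then have "b + b' \<in> V"
      using tendsto_add[of b 0 sequentially b' 0] by (auto simp: V_def plus_fun_def)
    moreover have "g (b + b') k \<le> g b k + g b' k" for k
      by (simp add: g_def scale_left_distrib sum.distrib norm_triangle_ineq)
    ultimately show "N (b + b') \<le> N b + N b'"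
      using tendsto_le[OF U_nb tendsto_add[OF lim[OF b(1)] lim[OF b(2)]] lim[of "b + b'"]] by simp
  qed (use c N_lower N_upper in auto)
  have truncV: "(\<lambda>j. if j \<in> F then a j else 0) \<in> V" if "finite F" for F and a :: "nat \<Rightarrow> 'k"
  proof -
    obtain m where "F \<subseteq> {..<m}" using finite_nat_iff_bounded \<open>finite F\<close> by blast
    then have "eventually (\<lambda>j. (if j \<in> F then a j else 0) = 0) sequentially"
      by (auto simp: eventually_sequentially intro!: exI[of _ m])
    then show ?thesis unfolding V_def by (simp add: tendsto_eventually)
  qed
  have combo: "(\<Sum>i\<in>F. seq_scale (a i) (s i)) = (\<lambda>j. if j \<in> F then a j else 0)"
    if "finite F" for F and a :: "nat \<Rightarrow> 'k"
    unfolding s_def using that by (rule sum_seq_scale_unit)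
  have "range s \<subseteq> V"
  proof clarify
    fix i
    have "s i = (\<lambda>j. if j \<in> {i} then 1 else 0)" by (auto simp: s_def)
    then show "s i \<in> V" using truncV[of "{i}" "\<lambda>_. 1"] by simp
  qed
  moreover have "generates_spreading_model sc norm y seq_scale N s"
    unfolding generates_spreading_model_def
  proof (intro allI impI)
    fix k :: nat and \<epsilon> :: real assume "1 \<le> k" and \<epsilon>: "0 < \<epsilon>"
    obtain m where m: "nearly_spreading_from m k (\<epsilon> / 2) y"
      using sp half_gt_zero[OF \<epsilon>] unfolding spreading_def by blast
    have "\<bar>N (\<Sum>i<k. seq_scale (a i) (s i)) - norm (\<Sum>i<k. sc (a i) (y (n i)))\<bar> < \<epsilon>"
      if n: "strict_mono_on {..<k} n" "\<forall>i<k. m \<le> n i" "\<forall>i<k. norm (a i) \<le> 1" for n a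
    proof -
      define b where "b = (\<lambda>j. if j \<in> {..<k} then a j else 0)"
      have bV: "b \<in> V" unfolding b_def by (rule truncV) simp
      have Nb: "N (\<Sum>i<k. seq_scale (a i) (s i)) = N b" by (simp add: combo b_def)
      have "eventually (\<lambda>j. max m k \<le> j) U"
        using eventually_ge_at_top U_free by (rule filter_leD[rotated])
      then have "eventually (\<lambda>j. \<bar>g b j - norm (\<Sum>i<k. sc (a i) (y (n i)))\<bar> \<le> \<epsilon> / 2) U"
      proof eventually_elim
        case (elim j)
        have "g b j = norm (\<Sum>i<k. sc (a i) (y (M j + i)))"
          unfolding g_def using elim
          by (intro arg_cong[of _ _ norm] sum.mono_neutral_cong_right) (auto simp: b_def)
        moreover have "strict_mono_on {..<k} (\<lambda>i. M j + i)" by (auto simp: strict_mono_on_def)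
        moreover have "m \<le> M j + i" for i using elim kM[of j] by simp
        ultimately show ?case
          using nearly_spreading_fromD[OF m _ n(1), of "\<lambda>i. M j + i" a] n by (simp add: less_imp_le)
      qed
      then have "\<bar>N b - norm (\<Sum>i<k. sc (a i) (y (n i)))\<bar> \<le> \<epsilon> / 2"
        by (rule tendsto_upperbound[OF tendsto_rabs[OF tendsto_diff[OF lim[OF bV] tendsto_const]] _ U_nb])
      then show ?thesis unfolding Nb using \<epsilon> by linarith
    qed
    then show "\<exists>m. \<forall>n a. strict_mono_on {..<k} n \<and> (\<forall>i<k. m \<le> n i) \<and> (\<forall>i<k. norm (a i) \<le> 1) \<longrightarrow>
        \<bar>N (\<Sum>i<k. seq_scale (a i) (s i)) - norm (\<Sum>i<k. sc (a i) (y (n i)))\<bar> < \<epsilon>" by blast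
  qed
  moreover have "equivalent_c0_basis seq_scale N s"
    unfolding equivalent_c0_basis_def
  proof (intro exI conjI ballI)
    show "0 < c" by (rule c)
    show "c \<le> max c C" by simp
    fix a :: "nat \<Rightarrow> 'k" assume a: "a \<in> c00"
    define S where "S = {i. a i \<noteq> 0}"
    have S: "finite S" using a by (simp add: S_def c00_def)
    have "lincomb seq_scale a s = (\<lambda>j. if j \<in> S then a j else 0)"
      unfolding lincomb_def S_def[symmetric] by (rule combo[OF S])
    moreover have "(\<lambda>j. if j \<in> S then a j else 0) = a" by (auto simp: S_def)
    ultimately have La: "lincomb seq_scale a s = a" and aV: "a \<in> V" using truncV[OF S, of a] by auto
    have fin: "finite (range (\<lambda>i. norm (a i)))"
    proof (rule finite_subset)
      show "range (\<lambda>i. norm (a i)) \<subseteq> insert 0 ((\<lambda>i. norm (a i)) ` S)" by (auto simp: S_def)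
    qed (use S in simp)
    obtain j where j: "(MAX i. norm (a i)) = norm (a j)"
      using Max_in[OF fin] by auto
    show "c * (MAX i. norm (a i)) \<le> N (lincomb seq_scale a s)"
      unfolding j La by (rule N_lower[OF aV])
    have "N a \<le> C * (MAX i. norm (a i))"
      using fin by (intro N_upper[OF aV]) simp
    also have "\<dots> \<le> max c C * (MAX i. norm (a i))"
      unfolding j by (intro mult_right_mono) auto
    finally show "N (lincomb seq_scale a s) \<le> max c C * (MAX i. norm (a i))" by (simp add: La)
  qed
  ultimately show ?thesis unfolding has_c0_spreading_model_def using ban by blast
qed

section \<open>Sequences without a c0 spreading model\<close>

lemma weakly_null_subseq:
  assumes "weakly_null sc x" "strict_mono r"
  shows "weakly_null sc (x \<circ> r)"
  unfolding weakly_null_def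
proof (intro allI impI)
  fix f :: "'a \<Rightarrow> 'k"
  assume "Vector_Spaces.linear sc (*) f \<and> (\<exists>B. \<forall>v. norm (f v) \<le> B * norm v)"
  then have "(\<lambda>n. f (x n)) \<longlonglongrightarrow> 0" using assms(1) unfolding weakly_null_def by blast
  from LIMSEQ_subseq_LIMSEQ[OF this assms(2)] show "(\<lambda>n. f ((x \<circ> r) n)) \<longlonglongrightarrow> 0"
    by (simp add: comp_def)
qed

lemma spreading_subsequence_exists:
  fixes x :: "nat \<Rightarrow> 'a"
  assumes B: "\<And>n. norm (x n) \<le> B"
  obtains r where "strict_mono r" "spreading (x \<circ> r)"
proof -
  obtain U where "free_ultrafilter U" using free_ultrafilter_exists by blast
  then interpret ultralimit_sequence sc x U B
    using B by unfold_locales auto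
  show thesis
  proof (rule spreading_subsequence)
    fix r :: "nat \<Rightarrow> nat"
    assume r: "strict_mono r" and sp: "\<And>k \<epsilon>. 0 < \<epsilon> \<Longrightarrow> \<exists>m::nat. \<forall>n n' (a :: nat \<Rightarrow> 'k).
        strict_mono_on {..<k} n \<and> strict_mono_on {..<k} n' \<and>
        (\<forall>i<k. m \<le> n i \<and> m \<le> n' i \<and> norm (a i) \<le> 1) \<longrightarrow>
        \<bar>norm (\<Sum>i<k. sc (a i) (x (r (n i)))) - norm (\<Sum>i<k. sc (a i) (x (r (n' i))))\<bar> < \<epsilon>"
    have "spreading (x \<circ> r)"
      unfolding spreading_def nearly_spreading_from_def comp_apply using sp by blast
    then show thesis by (rule that[OF r])
  qed
qed

text \<open>
  Along the subsequence given by projections onto single terms the coefficients are bounded by the norm,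
  which is the lower \<open>c\<^sub>0\<close> estimate.
\<close>

lemma spreading_unbounded_of_no_c0:
  assumes wn: "weakly_null sc x" and D: "0 < D" "\<And>n. D \<le> norm (x n)" and B: "\<And>n. norm (x n) \<le> B"
    and no_c0: "\<nexists>r. strict_mono r \<and> has_c0_spreading_model sc (x \<circ> r)"
    and sp: "spreading x"
  shows "\<not> bounded_sums x"
proof
  assume bounded: "bounded_sums x"
  obtain r where r: "strict_mono r" and sch: "schreier_projections (1 + 1) (\<lambda>_. 1) (x \<circ> r)"
    using schreier_projections_subsequence[OF wn D B zero_less_one] by metis
  have "has_c0_spreading_model sc (x \<circ> r)"
  proof (rule has_c0_spreading_model_of_bounded_sums)
    show "spreading (x \<circ> r)" using sp r by (rule spreading_subseq)
    show "bounded_sums (x \<circ> r)" using bounded r by (rule bounded_sums_subseq)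
    show "0 < D / 4" using D by simp
    show "D / 4 * norm (a i) \<le> norm (lincomb sc a (x \<circ> r))" if "a \<in> c00" for a i
      using schreier_projections_coefficient[OF sch that, where i = i and D = D] D(2) by simp
  qed
  then show False using no_c0 r by blast
qed

text \<open>
  Let \<open>N\<close> be the integer part of \<open>\<rho>\<parallel>v\<parallel> / B\<close>, or \<open>n\<close> if that is larger. Then
  \<open>\<parallel>v\<parallel> \<le> C N\<close>, so \<open>E\<close> has at most \<open>k N \<le> q N\<close> elements and the projection onto
  \<open>{..<N} \<union> E\<close> is controlled. The unwanted terms with indices in \<open>{n..<N}\<close> have norm at most
  \<open>\<rho>\<parallel>v\<parallel>\<close> together. Replacing \<open>\<delta>\<close> by its running minimum \<open>\<delta>'\<close> makes the bound \<open>k N\<close>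
  valid for the threshold \<open>\<delta> n\<close> with \<open>n \<le> N\<close>.
\<close>

proposition coefficient_threshold_projections:
  assumes wn: "weakly_null sc x" and D: "0 < D" "\<And>n. D \<le> norm (x n)" and B: "\<And>n. norm (x n) \<le> B"
    and no_c0: "\<nexists>r. strict_mono r \<and> has_c0_spreading_model sc (x \<circ> r)"
    and \<epsilon>: "0 < \<epsilon>" and \<delta>: "\<And>n. 0 < \<delta> n"
  obtains r where "strict_mono r"
    "\<forall>a\<in>c00. \<forall>n E. (\<forall>i. norm (a i) \<le> 1) \<and> E \<subseteq> {i. n \<le> i \<and> \<delta> n \<le> norm (a i)} \<longrightarrow>
       norm (\<Sum>i\<in>{..<n} \<union> E. sc (a i) (x (r i))) \<le> (1 + \<epsilon>) * norm (lincomb sc a (x \<circ> r))"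
proof -
  obtain r1 where r1: "strict_mono r1" and sp: "spreading (x \<circ> r1)"
    by (rule spreading_subsequence_exists[OF B])
  define y where "y = x \<circ> r1"
  have y: "weakly_null sc y" "\<And>n. D \<le> norm (y n)" "\<And>n. norm (y n) \<le> B" "spreading y"
    using weakly_null_subseq[OF wn r1] D(2) B sp by (simp_all add: y_def)
  have "\<not> has_c0_spreading_model sc (y \<circ> r)" if "strict_mono r" for r
    using no_c0 strict_mono_o[OF r1 that] by (auto simp: y_def comp_assoc)
  then have unb: "\<not> bounded_sums y"
    using spreading_unbounded_of_no_c0[OF y(1) D(1) y(2,3) _ y(4)] by blast
  have B0: "0 < B" using D(1) y(2)[of 0] y(3)[of 0] by linarith
  define \<rho> where "\<rho> = min (\<epsilon> / 2) 1"
  have \<rho>: "0 < \<rho>" "\<rho> \<le> 1" "2 * \<rho> \<le> \<epsilon>" using \<epsilon> by (auto simp: \<rho>_def)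
  \<comment> \<open>The running minimum, so that a threshold at level \<open>n\<close> is also one at each level \<open>N \<ge> n\<close>.\<close>
  define \<delta>' where "\<delta>' n = Min (\<delta> ` {..n})" for n
  have \<delta>': "0 < \<delta>' n" for n using \<delta> by (simp add: \<delta>'_def)
  have \<delta>'_le: "\<delta>' N \<le> \<delta> n" if "n \<le> N" for n N
    unfolding \<delta>'_def using that by (intro Min_le) auto
  \<comment> \<open>Vectors of norm at most \<open>C n\<close> are the ones that are treated at level \<open>n\<close>.\<close>
  define C where "C n = (real n + 1) * B / \<rho>" for n
  have "\<exists>k. \<forall>r q a. strict_mono r \<and> schreier_projections 2 q (y \<circ> r) \<and> (\<forall>n. n \<le> q n) \<and>
      a \<in> c00 \<and> (\<forall>i. norm (a i) \<le> 1) \<and> norm (lincomb sc a (y \<circ> r)) \<le> C n \<longrightarrow>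
      card {i. \<delta>' n \<le> norm (a i)} \<le> k" for n
    by (rule few_large_coefficients[OF y(4) unb y(3) \<delta>'[of n], of "C n"]) blast
  then obtain k where k: "\<And>n r q a. strict_mono r \<and> schreier_projections 2 q (y \<circ> r) \<and> (\<forall>n. n \<le> q n) \<and>
      a \<in> c00 \<and> (\<forall>i. norm (a i) \<le> 1) \<and> norm (lincomb sc a (y \<circ> r)) \<le> C n \<longrightarrow>
      card {i. \<delta>' n \<le> norm (a i)} \<le> k n"
    by metis
  define q where "q n = max n (k n)" for n
  obtain r2 where r2: "strict_mono r2" and sch: "schreier_projections (1 + \<rho>) q (y \<circ> r2)"
    using schreier_projections_subsequence[OF y(1) D(1) y(2,3) \<rho>(1), of q] by metis
  have sch2: "schreier_projections 2 q (y \<circ> r2)"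
    by (rule schreier_projections_mono[OF sch]) (use \<rho>(2) in simp)
  have yr: "y \<circ> r2 = x \<circ> (r1 \<circ> r2)" by (simp add: y_def comp_assoc)
  show thesis
  proof (rule that[of "r1 \<circ> r2"], rule strict_mono_o[OF r1 r2], intro ballI allI impI, elim conjE)
    fix a :: "nat \<Rightarrow> 'k" and n E
    assume a: "a \<in> c00" "\<forall>i. norm (a i) \<le> 1" and E: "E \<subseteq> {i. n \<le> i \<and> \<delta> n \<le> norm (a i)}"
    define v where "v = norm (lincomb sc a (y \<circ> r2))"
    have v0: "0 \<le> v" by (simp add: v_def)
    define N where "N = max n (nat \<lfloor>\<rho> * v / B\<rfloor>)"
    have fl: "real (nat \<lfloor>\<rho> * v / B\<rfloor>) \<le> \<rho> * v / B" "\<rho> * v / B < real (nat \<lfloor>\<rho> * v / B\<rfloor>) + 1"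
      using \<rho>(1) v0 B0 by (auto simp: floor_less_iff)
    have "\<rho> * v / B \<le> real N + 1" using fl(2) by (simp add: N_def)
    then have vC: "v \<le> C N" using \<rho>(1) B0 by (simp add: C_def field_simps)
    have head: "real (N - n) * B \<le> \<rho> * v"
    proof (cases "N = n")
      case True
      then show ?thesis using \<rho>(1) v0 by simp
    next
      case False
      then have "real (N - n) \<le> \<rho> * v / B" using fl(1) by (auto simp: N_def max_def split: if_splits)
      then show ?thesis using B0 by (simp add: field_simps)
    qed
    have fin: "finite {i. \<delta>' N \<le> norm (a i)}"
    proof (rule finite_subset)
      show "{i. \<delta>' N \<le> norm (a i)} \<subseteq> {i. a i \<noteq> 0}" using \<delta>'[of N] by auto
      show "finite {i. a i \<noteq> 0}" using a(1) by (simp add: c00_def)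
    qed
    have "n \<le> N" by (simp add: N_def)
    have sub: "E \<subseteq> {i. \<delta>' N \<le> norm (a i)}"
      using E \<delta>'_le[OF \<open>n \<le> N\<close>] by (auto intro: order_trans)
    then have finE: "finite E" using fin finite_subset by blast
    have "card E \<le> card {i. \<delta>' N \<le> norm (a i)}" using fin sub by (rule card_mono)
    also have "\<dots> \<le> k N" using k[of r2 q a N] r2 sch2 a vC by (simp add: q_def v_def)
    finally have cardE: "card E \<le> q N" by (simp add: q_def)
    define P where "P F = (\<Sum>i\<in>F. sc (a i) ((y \<circ> r2) i))" for F
    have "norm (P ({..<N} \<union> E)) \<le> (1 + \<rho>) * v"
      unfolding P_def v_def
    proof (rule schreier_projectionsD[OF sch a(1)])
      show "card ({..<N} \<union> E) \<le> N + q N" using card_Un_le[of "{..<N}" E] cardE by simp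
    qed (use finE in auto)
    moreover have "norm (P ({n..<N} - E)) \<le> \<rho> * v"
    proof -
      have "norm (P ({n..<N} - E)) \<le> real (card ({n..<N} - E)) * B"
      proof -
        have "norm (P ({n..<N} - E)) \<le> (\<Sum>i\<in>{n..<N} - E. B)"
          unfolding P_def
        proof (rule sum_norm_le)
          fix i
          have "norm (a i) * norm (y (r2 i)) \<le> 1 * B" using a(2) y(3) by (intro mult_mono) auto
          then show "norm (sc (a i) ((y \<circ> r2) i)) \<le> B" by (simp add: norm_scale)
        qed
        then show ?thesis by simp
      qed
      also have "\<dots> \<le> real (N - n) * B"
        using B0 card_mono[of "{n..<N}" "{n..<N} - E"] by (intro mult_right_mono) auto
      finally show ?thesis using head by linarith
    qed
    moreover have "P ({..<N} \<union> E) = P ({..<n} \<union> E) + P ({n..<N} - E)"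
    proof -
      have "{..<N} \<union> E = ({..<n} \<union> E) \<union> ({n..<N} - E)" using \<open>n \<le> N\<close> by auto
      then show ?thesis unfolding P_def using finE by (simp only:) (intro sum.union_disjoint, auto)
    qed
    then have "norm (P ({..<n} \<union> E)) \<le> norm (P ({..<N} \<union> E)) + norm (P ({n..<N} - E))"
      by (metis add_diff_cancel_right' norm_triangle_ineq4)
    ultimately have "norm (P ({..<n} \<union> E)) \<le> v + 2 * \<rho> * v" by (simp add: algebra_simps)
    also have "\<dots> \<le> (1 + \<epsilon>) * v"
      using mult_right_mono[OF \<rho>(3) v0] by (simp add: algebra_simps)
    finally show "norm (\<Sum>i\<in>{..<n} \<union> E. sc (a i) (x ((r1 \<circ> r2) i)))
        \<le> (1 + \<epsilon>) * norm (lincomb sc a (x \<circ> (r1 \<circ> r2)))"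
      unfolding P_def v_def yr by simp
  qed
qed

end

lemma seminormalizedE:
  assumes "seminormalized x"
  obtains D B where "0 < D" "\<And>n. D \<le> norm (x n)" "\<And>n. norm (x n) \<le> B"
proof -
  obtain B where "\<And>n. norm (x n) \<le> B"
    using assms unfolding seminormalized_def bdd_above_def by blast
  moreover have "(INF n. norm (x n)) \<le> norm (x n)" for n
    by (rule cINF_lower) (auto intro!: bdd_belowI2[where m = 0])
  ultimately show thesis using that[of "INF n. norm (x n)" B] assms by (simp add: seminormalized_def)
qed

theorem theorem1:
  fixes sc :: "'k::{real_normed_field, euclidean_space} \<Rightarrow> 'a::banach \<Rightarrow> 'a"
    and x :: "nat \<Rightarrow> 'a"
  assumes "normed_space_over sc"
    and "seminormalized x"
    and "weakly_null sc x"
  shows "(\<forall>\<epsilon>>0. \<forall>q :: nat \<Rightarrow> nat. (\<forall>i. 1 \<le> q i) \<longrightarrow>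
           (\<exists>r. strict_mono r \<and>
             (\<forall>n\<ge>1. \<forall>E. \<forall>a\<in>c00. finite E \<and> (\<forall>i\<in>E. n \<le> i) \<and> card E \<le> q n \<longrightarrow>
               norm ((\<Sum>i<n. sc (a i) (x (r i))) + (\<Sum>i\<in>E. sc (a i) (x (r i))))
                 \<le> (1 + \<epsilon>) * norm (lincomb sc a (x \<circ> r)))))
       \<and>
         ((\<nexists>r. strict_mono r \<and> has_c0_spreading_model sc (x \<circ> r)) \<longrightarrow>
           (\<forall>\<epsilon>>0. \<forall>\<delta> :: nat \<Rightarrow> real. (\<forall>n. 0 < \<delta> n \<and> \<delta> n < 1) \<longrightarrow>
             (\<exists>r. strict_mono r \<and>
               (\<forall>a\<in>c00. (\<forall>i. norm (a i) \<le> 1) \<longrightarrow>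
                 (\<forall>n\<ge>1. \<forall>E. E \<subseteq> {i. n \<le> i \<and> \<delta> n \<le> norm (a i)} \<longrightarrow>
                   norm ((\<Sum>i<n. sc (a i) (x (r i))) + (\<Sum>i\<in>E. sc (a i) (x (r i))))
                     \<le> (1 + \<epsilon>) * norm (lincomb sc a (x \<circ> r)))))))"
proof -
  interpret normed_space_over sc by (rule assms(1))
  obtain D B where D: "0 < D" "\<And>n. D \<le> norm (x n)" and B: "\<And>n. norm (x n) \<le> B"
    using seminormalizedE[OF assms(2)] by metis
  note wn = assms(3)
  have split: "(\<Sum>i<n. f i) + (\<Sum>i\<in>E. f i) = (\<Sum>i\<in>{..<n} \<union> E. f i)"
    if "finite E" "\<forall>i\<in>E. n \<le> i" for f :: "nat \<Rightarrow> 'a" and n E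
    using that by (subst sum.union_disjoint) auto
  show ?thesis
  proof (intro conjI allI impI)
    fix \<epsilon> :: real and q :: "nat \<Rightarrow> nat"
    assume "0 < \<epsilon>"
    then obtain r where r: "strict_mono r" and sch: "schreier_projections (1 + \<epsilon>) q (x \<circ> r)"
      using schreier_projections_subsequence[OF wn D B, of \<epsilon> q] by metis
    have "norm ((\<Sum>i<n. sc (a i) (x (r i))) + (\<Sum>i\<in>E. sc (a i) (x (r i))))
            \<le> (1 + \<epsilon>) * norm (lincomb sc a (x \<circ> r))"
      if "a \<in> c00" "finite E" "\<forall>i\<in>E. n \<le> i" "card E \<le> q n" for n E a
    proof -
      have "card ({..<n} \<union> E) \<le> n + q n" using card_Un_le[of "{..<n}" E] that(4) by simp
      then show ?thesis
        unfolding split[OF that(2,3)] using schreier_projectionsD[OF sch that(1), of "{..<n} \<union> E" n] that(2)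
        by simp
    qed
    then show "\<exists>r. strict_mono r \<and>
             (\<forall>n\<ge>1. \<forall>E. \<forall>a\<in>c00. finite E \<and> (\<forall>i\<in>E. n \<le> i) \<and> card E \<le> q n \<longrightarrow>
               norm ((\<Sum>i<n. sc (a i) (x (r i))) + (\<Sum>i\<in>E. sc (a i) (x (r i))))
                 \<le> (1 + \<epsilon>) * norm (lincomb sc a (x \<circ> r)))"
      using r by blast
  next
    fix \<epsilon> :: real and \<delta> :: "nat \<Rightarrow> real"
    assume no_c0: "\<nexists>r. strict_mono r \<and> has_c0_spreading_model sc (x \<circ> r)"
      and \<epsilon>: "0 < \<epsilon>" and \<delta>: "\<forall>n. 0 < \<delta> n \<and> \<delta> n < 1"
    have \<delta>_pos: "\<And>n. 0 < \<delta> n" using \<delta> by blast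
    obtain r where r: "strict_mono r" and proj:
      "\<forall>a\<in>c00. \<forall>n E. (\<forall>i. norm (a i) \<le> 1) \<and> E \<subseteq> {i. n \<le> i \<and> \<delta> n \<le> norm (a i)} \<longrightarrow>
         norm (\<Sum>i\<in>{..<n} \<union> E. sc (a i) (x (r i))) \<le> (1 + \<epsilon>) * norm (lincomb sc a (x \<circ> r))"
      by (rule coefficient_threshold_projections[OF wn D B no_c0 \<epsilon> \<delta>_pos])
    have "norm ((\<Sum>i<n. sc (a i) (x (r i))) + (\<Sum>i\<in>E. sc (a i) (x (r i))))
            \<le> (1 + \<epsilon>) * norm (lincomb sc a (x \<circ> r))"
      if a: "a \<in> c00" "\<forall>i. norm (a i) \<le> 1" and E: "E \<subseteq> {i. n \<le> i \<and> \<delta> n \<le> norm (a i)}" for a n E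
    proof -
      have "E \<subseteq> {i. a i \<noteq> 0}" using E \<delta>_pos[of n] by auto
      then have "finite E" using a(1) finite_subset unfolding c00_def by blast
      moreover have "\<forall>i\<in>E. n \<le> i" using E by blast
      ultimately show ?thesis unfolding split[OF \<open>finite E\<close> \<open>\<forall>i\<in>E. n \<le> i\<close>] using proj a E by blast
    qed
    then show "\<exists>r. strict_mono r \<and>
               (\<forall>a\<in>c00. (\<forall>i. norm (a i) \<le> 1) \<longrightarrow>
                 (\<forall>n\<ge>1. \<forall>E. E \<subseteq> {i. n \<le> i \<and> \<delta> n \<le> norm (a i)} \<longrightarrow>
                   norm ((\<Sum>i<n. sc (a i) (x (r i))) + (\<Sum>i\<in>E. sc (a i) (x (r i))))
                     \<le> (1 + \<epsilon>) * norm (lincomb sc a (x \<circ> r))))"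
      using r by blast
  qed
qed

end
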